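(* Let $M$ be a closed manifold and let $f\in \operatorname{Diff}^1(M)$. Let $S\subset \Omega(f)$ be a set of nonwandering points of $f$ which is uniformly bounded with respect to some map $n:S\to\mathbb{N}^+$ with finite preimages. Then $S$ is finite.
   Context: A closed manifold is a compact connected boundaryless manifold $M$ with $\dim(M)\ge 2$, equipped with a Riemannian metric inducing norms $\|\cdot\|$ on tangent spaces and on linear maps between them. $\operatorname{Diff}^1(M)$ is the space of $C^1$ diffeomorphisms of $M$ with the $C^1$ topology. $\mathbb{N}^+$ denotes the positive integers. A point $p\in M$ is wandering for $f$ if $U\cap\left(\bigcup_{n\in\mathbb{N}^+}f^n(U)\right)=\emptyset$ for some neighborhood $U$ of $p$; otherwise $p$ is nonwandering. $\Omega(f)$ is the set of nonwandering points. A map $n:O\to Q$ has finite preimages if $n^{-1}(k)$ is finite for every $k\in Q$. A (not necessarily invariant) set $S\subset M$ is uniformly bounded with respect to a map $n:S\to\mathbb{N}^+$ if there are positive constants $\epsilon,K$ such that $\left\|\prod_{i=0}^{n(p)-1}L_i\right\|\le K$ for all $p\in S$ and every sequence of linear isomorphisms $L_i:T_{f^i(p)}M\to T_{f^{i+1}(p)}M$ with $\|L_i-Df(f^i(p))\|\le\epsilon$ for $0\le i\le n(p)-1$. Here $\prod_{i=0}^{k-1}L_i$ denotes the composition $L_{k-1}\cdots L_1L_0$. *)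

theory Defs
  imports "HOL-Analysis.Analysis"
begin

text \<open>
  \<open>C\<^sup>k\<close> functions, to be used for open \<open>X\<close> only, since the derivatives are
  taken in the full space. For finite-dimensional domains, continuity of all directional derivatives is the same as
  continuity of the derivative as a map into the space of linear maps.
\<close>

primrec Ck_on ::
  "nat \<Rightarrow> ('e::euclidean_space \<Rightarrow> 'b::real_normed_vector) \<Rightarrow> 'e set \<Rightarrow> bool" where
  "Ck_on 0 f X \<longleftrightarrow> continuous_on X f"
| "Ck_on (Suc k) f X \<longleftrightarrow>
     (\<forall>x\<in>X. f differentiable (at x)) \<and>
     (\<forall>v. Ck_on k (\<lambda>x. frechet_derivative f (at x) v) X)"

definition smooth_on ::
  "('e::euclidean_space \<Rightarrow> 'b::real_normed_vector) \<Rightarrow> 'e set \<Rightarrow> bool" where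
  "smooth_on f X \<longleftrightarrow> (\<forall>k. Ck_on k f X)"

text \<open>
  A chart is a domain together with a coordinate map, whose values outside of the domain
  are irrelevant. Atlases are not required to be maximal. The dimension of the manifold is
  the dimension of the model space \<open>'e\<close>; charts map onto open subsets of \<open>'e\<close>, so
  that there is no boundary.
\<close>

type_synonym ('a, 'e) chart = "'a set \<times> ('a \<Rightarrow> 'e)"

abbreviation chart_dom :: "('a, 'e) chart \<Rightarrow> 'a set" where
  "chart_dom c \<equiv> fst c"

abbreviation chart_map :: "('a, 'e) chart \<Rightarrow> 'a \<Rightarrow> 'e" where
  "chart_map c \<equiv> snd c"

definition chart_inv :: "('a, 'e) chart \<Rightarrow> 'e \<Rightarrow> 'a" where
  "chart_inv c = inv_into (chart_dom c) (chart_map c)"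

definition is_chart ::
  "'a::topological_space set \<Rightarrow> ('a, 'e::euclidean_space) chart \<Rightarrow> bool" where
  "is_chart M c \<longleftrightarrow>
     openin (top_of_set M) (chart_dom c) \<and>
     open (chart_map c ` chart_dom c) \<and>
     homeomorphism (chart_dom c) (chart_map c ` chart_dom c) (chart_map c) (chart_inv c)"

definition smooth_atlas ::
  "'a::topological_space set \<Rightarrow> ('a, 'e::euclidean_space) chart set \<Rightarrow> bool" where
  "smooth_atlas M A \<longleftrightarrow>
     (\<forall>c\<in>A. is_chart M c) \<and>
     (\<Union>c\<in>A. chart_dom c) = M \<and>
     (\<forall>c\<in>A. \<forall>c'\<in>A.
        smooth_on (chart_map c' \<circ> chart_inv c) (chart_map c ` (chart_dom c \<inter> chart_dom c')))"

definition closed_manifold ::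
  "'a::t2_space set \<Rightarrow> ('a, 'e::euclidean_space) chart set \<Rightarrow> bool" where
  "closed_manifold M A \<longleftrightarrow>
     compact M \<and> connected M \<and> smooth_atlas M A \<and> 2 \<le> DIM('e)"

text \<open>
  A tangent vector at \<open>p\<close> is the family of its coordinate vectors with respect to all charts
  around \<open>p\<close>, which transform under the derivatives of the transition maps. The family is
  extended by \<open>0\<close> to all other charts, so that equality of tangent vectors is equality of
  functions. The vector space operations are pointwise.
\<close>

type_synonym ('a, 'e) tvector = "('a, 'e) chart \<Rightarrow> 'e"

definition charts_at :: "('a, 'e) chart set \<Rightarrow> 'a \<Rightarrow> ('a, 'e) chart set" where
  "charts_at A p = {c \<in> A. p \<in> chart_dom c}"

definition tangent_space ::
  "('a, 'e::euclidean_space) chart set \<Rightarrow> 'a \<Rightarrow> ('a, 'e) tvector set" where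
  "tangent_space A p =
     {v. (\<forall>c\<in>charts_at A p. \<forall>c'\<in>charts_at A p.
            v c' = frechet_derivative (chart_map c' \<circ> chart_inv c) (at (chart_map c p)) (v c)) \<and>
         (\<forall>c. c \<notin> charts_at A p \<longrightarrow> v c = 0)}"

text \<open>The tangent vector at \<open>p\<close> whose coordinate vector in the chart \<open>c\<close> around \<open>p\<close> is \<open>u\<close>:\<close>

definition coord_vector ::
  "('a, 'e::euclidean_space) chart set \<Rightarrow> ('a, 'e) chart \<Rightarrow> 'a \<Rightarrow> 'e \<Rightarrow> ('a, 'e) tvector" where
  "coord_vector A c p u =
     (\<lambda>c'. if c' \<in> charts_at A p
           then frechet_derivative (chart_map c' \<circ> chart_inv c) (at (chart_map c p)) u
           else 0)"

definition tangent_linear ::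
  "('a, 'e::euclidean_space) chart set \<Rightarrow> 'a \<Rightarrow> 'a \<Rightarrow>
     (('a, 'e) tvector \<Rightarrow> ('a, 'e) tvector) \<Rightarrow> bool" where
  "tangent_linear A p q L \<longleftrightarrow>
     L ` tangent_space A p \<subseteq> tangent_space A q \<and>
     (\<forall>v\<in>tangent_space A p. \<forall>w\<in>tangent_space A p. \<forall>a b :: real.
        L (\<lambda>c. a *\<^sub>R v c + b *\<^sub>R w c) = (\<lambda>c. a *\<^sub>R L v c + b *\<^sub>R L w c))"

definition tangent_iso ::
  "('a, 'e::euclidean_space) chart set \<Rightarrow> 'a \<Rightarrow> 'a \<Rightarrow>
     (('a, 'e) tvector \<Rightarrow> ('a, 'e) tvector) \<Rightarrow> bool" where
  "tangent_iso A p q L \<longleftrightarrow>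
     tangent_linear A p q L \<and> bij_betw L (tangent_space A p) (tangent_space A q)"

definition riemannian_metric ::
  "'a set \<Rightarrow> ('a, 'e::euclidean_space) chart set \<Rightarrow>
     ('a \<Rightarrow> ('a, 'e) tvector \<Rightarrow> ('a, 'e) tvector \<Rightarrow> real) \<Rightarrow> bool" where
  "riemannian_metric M A g \<longleftrightarrow>
     (\<forall>p\<in>M. \<forall>u\<in>tangent_space A p. \<forall>v\<in>tangent_space A p. \<forall>w\<in>tangent_space A p. \<forall>a b.
        g p (\<lambda>c. a *\<^sub>R u c + b *\<^sub>R v c) w = a * g p u w + b * g p v w) \<and>
     (\<forall>p\<in>M. \<forall>v\<in>tangent_space A p. \<forall>w\<in>tangent_space A p. g p v w = g p w v) \<and>
     (\<forall>p\<in>M. \<forall>v\<in>tangent_space A p. v \<noteq> (\<lambda>_. 0) \<longrightarrow> 0 < g p v v) \<and>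
     (\<forall>c\<in>A. \<forall>u w.
        smooth_on (\<lambda>x. g (chart_inv c x) (coord_vector A c (chart_inv c x) u)
                                         (coord_vector A c (chart_inv c x) w))
          (chart_map c ` chart_dom c))"

definition tangent_norm ::
  "('a \<Rightarrow> ('a, 'e) tvector \<Rightarrow> ('a, 'e) tvector \<Rightarrow> real) \<Rightarrow> 'a \<Rightarrow> ('a, 'e) tvector \<Rightarrow> real" where
  "tangent_norm g p v = sqrt (g p v v)"

text \<open>
  The operator norm of a linear map from the tangent space at \<open>p\<close> to the one at \<open>q\<close>. The supremum
  is over a bounded set, as tangent spaces are finite-dimensional.
\<close>

definition tangent_opnorm ::
  "('a, 'e::euclidean_space) chart set \<Rightarrow>
     ('a \<Rightarrow> ('a, 'e) tvector \<Rightarrow> ('a, 'e) tvector \<Rightarrow> real) \<Rightarrow> 'a \<Rightarrow> 'a \<Rightarrow>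
     (('a, 'e) tvector \<Rightarrow> ('a, 'e) tvector) \<Rightarrow> real" where
  "tangent_opnorm A g p q L =
     (SUP v\<in>{v \<in> tangent_space A p. tangent_norm g p v \<le> 1}. tangent_norm g q (L v))"

definition C1_map ::
  "'a::topological_space set \<Rightarrow> ('a, 'e::euclidean_space) chart set \<Rightarrow> ('a \<Rightarrow> 'a) \<Rightarrow> bool" where
  "C1_map M A f \<longleftrightarrow>
     f ` M \<subseteq> M \<and> continuous_on M f \<and>
     (\<forall>c\<in>A. \<forall>c'\<in>A.
        Ck_on 1 (chart_map c' \<circ> f \<circ> chart_inv c)
          (chart_map c ` {x \<in> chart_dom c. f x \<in> chart_dom c'}))"

definition Diff1 ::
  "'a::topological_space set \<Rightarrow> ('a, 'e::euclidean_space) chart set \<Rightarrow> ('a \<Rightarrow> 'a) set" where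
  "Diff1 M A = {f. bij_betw f M M \<and> C1_map M A f \<and> C1_map M A (inv_into M f)}"

text \<open>
  The differential of \<open>f\<close> at \<open>p\<close>: the coordinates of the image vector are obtained from those
  of \<open>v\<close> by the derivatives of the coordinate representations of \<open>f\<close>.
\<close>

definition differential ::
  "('a, 'e::euclidean_space) chart set \<Rightarrow> ('a \<Rightarrow> 'a) \<Rightarrow> 'a \<Rightarrow>
     ('a, 'e) tvector \<Rightarrow> ('a, 'e) tvector" where
  "differential A f p v =
     (THE w. w \<in> tangent_space A (f p) \<and>
        (\<forall>c\<in>charts_at A p. \<forall>c'\<in>charts_at A (f p).
           w c' = frechet_derivative (chart_map c' \<circ> f \<circ> chart_inv c)
                    (at (chart_map c p)) (v c)))"

definition wandering :: "'a::topological_space set \<Rightarrow> ('a \<Rightarrow> 'a) \<Rightarrow> 'a \<Rightarrow> bool" where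
  "wandering M f p \<longleftrightarrow>
     (\<exists>U. openin (top_of_set M) U \<and> p \<in> U \<and> U \<inter> (\<Union>n\<in>{1..}. (f ^^ n) ` U) = {})"

definition nonwandering_set :: "'a::topological_space set \<Rightarrow> ('a \<Rightarrow> 'a) \<Rightarrow> 'a set" where
  "nonwandering_set M f = {p \<in> M. \<not> wandering M f p}"

definition finite_preimages :: "'o set \<Rightarrow> 'q set \<Rightarrow> ('o \<Rightarrow> 'q) \<Rightarrow> bool" where
  "finite_preimages X Y n \<longleftrightarrow> (\<forall>k\<in>Y. finite {x \<in> X. n x = k})"

text \<open>The composition \<open>L (k - 1) \<circ> \<dots> \<circ> L 1 \<circ> L 0\<close>:\<close>

primrec comp_seq :: "(nat \<Rightarrow> 'v \<Rightarrow> 'v) \<Rightarrow> nat \<Rightarrow> 'v \<Rightarrow> 'v" where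
  "comp_seq L 0 = id"
| "comp_seq L (Suc k) = L k \<circ> comp_seq L k"

definition uniformly_bounded ::
  "('a, 'e::euclidean_space) chart set \<Rightarrow>
     ('a \<Rightarrow> ('a, 'e) tvector \<Rightarrow> ('a, 'e) tvector \<Rightarrow> real) \<Rightarrow>
     ('a \<Rightarrow> 'a) \<Rightarrow> 'a set \<Rightarrow> ('a \<Rightarrow> nat) \<Rightarrow> bool" where
  "uniformly_bounded A g f S n \<longleftrightarrow>
     (\<exists>\<epsilon>>0. \<exists>K>0. \<forall>p\<in>S. \<forall>L :: nat \<Rightarrow> ('a, 'e) tvector \<Rightarrow> ('a, 'e) tvector.
        (\<forall>i<n p.
           tangent_iso A ((f ^^ i) p) ((f ^^ Suc i) p) (L i) \<and>
           tangent_opnorm A g ((f ^^ i) p) ((f ^^ Suc i) p)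
             (\<lambda>v c. L i v c - differential A f ((f ^^ i) p) v c) \<le> \<epsilon>) \<longrightarrow>
        tangent_opnorm A g p ((f ^^ n p) p) (comp_seq L (n p)) \<le> K)"

end

theory Submission
  imports Defs
begin

text \<open>
  Robustness of the bound under perturbation forces contraction. Fix \<open>m\<close> and replace each differential by
  \<open>1 + d\<close> times itself; at the start of each block of length \<open>m\<close>, also tilt the current vector
  slightly towards the direction most expanded by that block, with the sign that helps. The product grows at least
  like the product of the numbers \<open>d (1 + d)\<^sup>m \<parallel>Df\<^sup>m\<parallel>\<close> along the orbit, so for large \<open>m\<close>
  the product of the norms \<open>\<parallel>Df\<^sup>m\<parallel>\<close> decays exponentially. If \<open>S\<close> were infinite, then \<open>n\<close>
  would be unbounded on it, and a Pliss argument would give, on the orbits of infinitely many points of \<open>S\<close>,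
  points \<open>q\<close> from which \<open>f\<^sup>m\<close> contracts uniformly for longer and longer times. Near an accumulation
  point of these, an open set \<open>W\<close> shrinks under iteration. All nonwandering points in \<open>W\<close> then coincide
  with a single periodic point, so infinitely many points of \<open>S\<close> would lie on one periodic orbit.
\<close>

section \<open>Perturbed products of linear maps\<close>

text \<open>A tilt of size \<open>d\<close> only secures the fraction \<open>d\<close> of the norm
  of a block. Inflating every factor by \<open>1 + d\<close> wins this back, once \<open>m\<close>
  is so large that \<open>d * (1 + d) ^ m\<close> is at least 8. The 8 is spent as three factors 2:
  one gives the contraction rate 1/2, one makes the run of contracting blocks long, and one absorbs
  the nonlinear error in passing from the derivative of \<open>f ^^ m\<close> to the map itself. The
  perturbations are attached to times and not to points, so an orbit that revisits a point causes no
  conflict, and no perturbation has to be realised by a diffeomorphism. The contracting points vary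
  and each contracts for a finite time only. What makes an accumulation point useful is that the
  radius on which the derivative governs the map is the same for all points and all times. No
  distance on \<open>M\<close> is used. Estimates are made in coordinates, in one chosen chart per
  point, with constants made uniform by compactness; and that \<open>W\<close> shrinks is expressed
  by open covers of \<open>M\<close> with two members, one of which must contain each late image of
  \<open>W\<close>.\<close>

lemma comp_seq_cong: "(\<And>i. i < n \<Longrightarrow> L i = L' i) \<Longrightarrow> comp_seq L n = comp_seq L' n"
  by (induction n) auto

lemma comp_seq_add: "comp_seq L (a + b) = comp_seq (\<lambda>i. L (a + i)) b \<circ> comp_seq L a"
  by (induction b) (auto simp: fun_eq_iff)

lemma linear_comp_seq: "(\<And>i. i < n \<Longrightarrow> linear (L i)) \<Longrightarrow> linear (comp_seq L n)"
  by (induction n) (auto intro!: linear_compose simp: linear_id)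

lemma bij_comp_seq: "(\<And>i. bij (L i)) \<Longrightarrow> bij (comp_seq L n)"
  by (induction n) (simp_all only: comp_seq.simps bij_id bij_comp)

lemma comp_seq_scale:
  fixes D :: "nat \<Rightarrow> 'e::real_vector \<Rightarrow> 'e"
  assumes "\<And>i. linear (D i)"
  shows "comp_seq (\<lambda>i z. a *\<^sub>R D i z) n z = a ^ n *\<^sub>R comp_seq D n z"
  by (induction n) (auto simp: linear_scale[OF assms])

lemma comp_seq_norm_ge:
  fixes D :: "nat \<Rightarrow> 'e::real_normed_vector \<Rightarrow> 'e"
  assumes "\<And>i z. norm z \<le> B * norm (D i z)" "B \<ge> 0"
  shows "norm z \<le> B ^ n * norm (comp_seq D n z)"
proof (induction n)
  case (Suc n)
  have "B ^ n * norm (comp_seq D n z) \<le> B ^ n * (B * norm (D n (comp_seq D n z)))"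
    using assms by (intro mult_left_mono) auto
  with Suc show ?case by (simp add: mult_ac)
qed auto

lemma comp_seq_norm_le:
  fixes D :: "nat \<Rightarrow> 'e::real_normed_vector \<Rightarrow> 'e"
  assumes "\<And>i z. norm (D i z) \<le> B * norm z" "B \<ge> 0"
  shows "norm (comp_seq D n z) \<le> B ^ n * norm z"
proof (induction n)
  case (Suc n)
  have "norm (D n (comp_seq D n z)) \<le> B * norm (comp_seq D n z)" using assms by auto
  also have "\<dots> \<le> B * (B ^ n * norm z)" using Suc assms(2) by (intro mult_left_mono) auto
  finally show ?case by (simp add: mult_ac)
qed auto

lemma onorm_attained:
  fixes T :: "'e::euclidean_space \<Rightarrow> 'e"
  assumes "linear T"
  obtains v where "norm v = 1" "norm (T v) = onorm T"
proof -
  have "compact (sphere (0::'e) 1)" "sphere (0::'e) 1 \<noteq> {}" by auto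
  moreover have "continuous_on (sphere (0::'e) 1) (\<lambda>x. norm (T x))"
    by (intro continuous_on_norm linear_continuous_on linear_conv_bounded_linear[THEN iffD1] assms)
  ultimately obtain v where v: "v \<in> sphere 0 1" "\<And>w. w \<in> sphere 0 1 \<Longrightarrow> norm (T w) \<le> norm (T v)"
    using continuous_attains_sup by metis
  have bl: "bounded_linear T" using assms linear_conv_bounded_linear by blast
  have "onorm T \<le> norm (T v)"
  proof (rule onorm_le)
    fix x show "norm (T x) \<le> norm (T v) * norm x"
    proof (cases "x = 0")
      case False
      then have "norm (T (x /\<^sub>R norm x)) \<le> norm (T v)" by (intro v) auto
      then show ?thesis using False by (simp add: linear_scale[OF assms] field_simps)
    qed (simp add: linear_0[OF assms])
  qed
  moreover have "norm (T v) \<le> onorm T" using onorm[OF bl, of v] v by simp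
  ultimately show thesis using that[of v] v by auto
qed

text \<open>\<open>L\<close> is \<open>(1 + d) *\<^sub>R D\<close> after the identity plus a
  rank-one map of norm at most \<open>d\<close>. Since \<open>d\<close> is at most 1/2, the inner
  map is injective. The error is \<open>D\<close> applied to a vector of norm at most
  \<open>d + (1 + d) * d\<close>, hence at most \<open>3 * d\<close>, times that of
  \<open>z\<close>. Taking \<open>s = 0\<close> gives the plain scaling.\<close>

lemma tilt_close:
  fixes D :: "'e::euclidean_space \<Rightarrow> 'e"
  assumes lin: "linear D" and up: "\<And>z. norm (D z) \<le> B * norm z" and lo: "\<And>z. norm z \<le> B * norm (D z)"
    and B: "B \<ge> 1" and d: "0 \<le> d" "d \<le> 1/2" "3 * B * d \<le> e" and s: "\<bar>s\<bar> \<le> d"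
    and u: "norm u = 1" and v: "norm v = 1"
  defines "L \<equiv> \<lambda>z. (1 + d) *\<^sub>R D (z + (s * (z \<bullet> u)) *\<^sub>R v)"
  shows "linear L" "bij L" "\<And>z. norm (L z - D z) \<le> e * norm z"
proof -
  interpret D: linear D by fact
  show linL: "linear L" unfolding L_def
    by (rule linearI) (simp_all add: D.add[symmetric] D.scale[symmetric] algebra_simps)
  have sz: "norm ((s * (z \<bullet> u)) *\<^sub>R v) \<le> d * norm z" for z
  proof -
    have "\<bar>z \<bullet> u\<bar> \<le> norm z" using Cauchy_Schwarz_ineq2[of z u] u by simp
    then have "\<bar>s\<bar> * \<bar>z \<bullet> u\<bar> \<le> d * norm z" using s d by (intro mult_mono) auto
    then show ?thesis using v by (simp add: abs_mult)
  qed
  have "inj L"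
  proof (rule linear_injective_0[OF linL, THEN iffD2], safe)
    fix z assume "L z = 0"
    then have "D (z + (s * (z \<bullet> u)) *\<^sub>R v) = 0" using d by (auto simp: L_def)
    then have "z + (s * (z \<bullet> u)) *\<^sub>R v = 0" using lo[of "z + (s * (z \<bullet> u)) *\<^sub>R v"] by simp
    then have "z = - ((s * (z \<bullet> u)) *\<^sub>R v)" by (simp add: eq_neg_iff_add_eq_0)
    then have "norm z \<le> d * norm z" using sz[of z] by (metis norm_minus_cancel)
    also have "\<dots> \<le> 1/2 * norm z" using d by (intro mult_right_mono) auto
    finally show "z = 0" by simp
  qed
  then show "bij L" using linear_injective_imp_surjective[OF linL] by (simp add: bij_def)
  fix z
  let ?w = "(s * (z \<bullet> u)) *\<^sub>R v"
  have "L z - D z = D (d *\<^sub>R z + (1 + d) *\<^sub>R ?w)"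
    unfolding L_def by (simp add: D.add D.scale algebra_simps)
  also have "norm \<dots> \<le> B * norm (d *\<^sub>R z + (1 + d) *\<^sub>R ?w)" by (rule up)
  also have "\<dots> \<le> B * (3 * d * norm z)"
  proof (intro mult_left_mono)
    have "norm (d *\<^sub>R z + (1 + d) *\<^sub>R ?w) \<le> norm (d *\<^sub>R z) + norm ((1 + d) *\<^sub>R ?w)"
      by (rule norm_triangle_ineq)
    also have "\<dots> = d * norm z + (1 + d) * norm ?w" using d by (simp only: norm_scaleR)
    also have "\<dots> \<le> d * norm z + 2 * (d * norm z)"
      using sz[of z] d by (intro add_left_mono mult_mono) auto
    finally show "norm (d *\<^sub>R z + (1 + d) *\<^sub>R ?w) \<le> 3 * d * norm z" by simp
  qed (use B in auto)
  also have "\<dots> \<le> e * norm z" using mult_right_mono[OF d(3), of "norm z"] by (simp add: mult_ac)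
  finally show "norm (L z - D z) \<le> e * norm z" .
qed

text \<open>Induction on the number of blocks with the vector \<open>u\<close> kept fixed. Because
  \<open>L\<close> equals \<open>D\<close> from time \<open>k * m\<close> on, the next block can be
  changed without disturbing the growth already gained.\<close>

lemma aligned_perturbation:
  fixes D :: "nat \<Rightarrow> 'e::euclidean_space \<Rightarrow> 'e"
  assumes lin: "\<And>i. linear (D i)" and up: "\<And>i z. norm (D i z) \<le> B * norm z"
    and lo: "\<And>i z. norm z \<le> B * norm (D i z)"
    and B: "B \<ge> 1" and d: "0 < d" "d \<le> 1/2" "3 * B * d \<le> e" and m: "m > 0"
  shows "\<exists>L u. (\<forall>i. linear (L i) \<and> bij (L i) \<and> (\<forall>z. norm (L i z - D i z) \<le> e * norm z)) \<and>
           (\<forall>i\<ge>k * m. L i = D i) \<and> norm u = 1 \<and>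
           (\<Prod>j<k. d * (1 + d) ^ m * onorm (comp_seq (\<lambda>i. D (j * m + i)) m)) \<le> norm (comp_seq L (k * m) u)"
proof (induction k)
  have e: "e > 0" using d B by (smt (verit) mult_pos_pos)
  have D0: "linear (D i)" "bij (D i)" "norm (D i z - D i z) \<le> e * norm z" for i z
  proof -
    have "inj (D i)" using lo[of _ i] by (subst linear_injective_0[OF lin]) (metis mult_zero_right norm_le_zero_iff norm_zero)
    then show "bij (D i)" using linear_injective_imp_surjective[OF lin] by (simp add: bij_def)
  qed (use lin e in auto)
  {
    case 0
    obtain u :: 'e where "norm u = 1" using vector_choose_size[of 1] by auto
    then show ?case by (intro exI[of _ D] exI[of _ u]) (use D0 in auto)
  }
  case (Suc k)
  then obtain L u where L: "\<And>i. linear (L i)" "\<And>i. bij (L i)" "\<And>i z. norm (L i z - D i z) \<le> e * norm z"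
    and u: "norm u = 1"
    and ge: "(\<Prod>j<k. d * (1 + d) ^ m * onorm (comp_seq (\<lambda>i. D (j * m + i)) m)) \<le> norm (comp_seq L (k * m) u)"
    by auto
  define w where "w = comp_seq L (k * m) u"
  have "inj (comp_seq L (k * m))" by (intro bij_is_inj bij_comp_seq L)
  then have w0: "w \<noteq> 0"
    using linear_injective_0[OF linear_comp_seq[of "k * m" L, OF L(1)]] u unfolding w_def by fastforce
  define T where "T = comp_seq (\<lambda>i. D (k * m + i)) m"
  have linT: "linear T" unfolding T_def by (rule linear_comp_seq) (rule lin)
  obtain v where v: "norm v = 1" "norm (T v) = onorm T" using onorm_attained[OF linT] by blast
  define y where "y = w /\<^sub>R norm w"
  have y: "norm y = 1" using w0 by (simp add: y_def)
  \<comment> \<open>The two tilted images differ by \<open>2 * d\<close> times \<open>T v\<close>,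
    where \<open>v\<close> is the most expanded unit vector, so at least one of them has norm at
    least \<open>d * onorm T\<close>. This decides the sign of the tilt.\<close>
  have Tpm: "2 * d * onorm T \<le> norm (T (y + d *\<^sub>R v)) + norm (T (y - d *\<^sub>R v))"
  proof -
    have "2 * d * onorm T = norm (T (y + d *\<^sub>R v) - T (y - d *\<^sub>R v))"
      using v d by (simp add: linear_diff[OF linT, symmetric] scaleR_2[symmetric] linear_scale[OF linT])
    then show ?thesis using norm_triangle_ineq4 by metis
  qed
  then have "\<exists>s. \<bar>s\<bar> \<le> d \<and> d * onorm T \<le> norm (T (y + s *\<^sub>R v))"
  proof (cases "d * onorm T \<le> norm (T (y + d *\<^sub>R v))")
    case False
    then have "d * onorm T \<le> norm (T (y + (- d) *\<^sub>R v))" using Tpm by auto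
    then show ?thesis using d by (metis abs_minus_cancel abs_of_pos order_refl)
  qed (use d in \<open>auto intro!: exI[of _ d]\<close>)
  then obtain s where s: "\<bar>s\<bar> \<le> d" "d * onorm T \<le> norm (T (y + s *\<^sub>R v))" by blast
  \<comment> \<open>Only the map at time \<open>k * m\<close> is tilted; the others in the block
    have tilt 0 and are merely scaled. As \<open>y\<close> is the direction of \<open>w\<close>, the
    tilt sends \<open>w\<close> to \<open>norm w\<close> times
    \<open>y + s *\<^sub>R v\<close>.\<close>
  define L' where "L' i = (if i < k * m then L i
     else if i < Suc k * m then (\<lambda>z. (1 + d) *\<^sub>R D i (z + ((if i = k * m then s else 0) * (z \<bullet> y)) *\<^sub>R v))
     else D i)" for i
  have L'lin: "linear (L' i) \<and> bij (L' i) \<and> (\<forall>z. norm (L' i z - D i z) \<le> e * norm z)" for i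
  proof -
    have "\<bar>if i = k * m then s else 0\<bar> \<le> d" using s d by auto
    note tc = tilt_close[OF lin up lo B less_imp_le[OF d(1)] d(2,3) this y v(1), of i]
    show ?thesis using tc L D0 unfolding L'_def by (cases "i < k * m"; cases "i < Suc k * m") auto
  qed
  have c1: "comp_seq L' (k * m) = comp_seq L (k * m)"
    by (rule comp_seq_cong) (auto simp: L'_def)
  have c2: "comp_seq (\<lambda>i. L' (k * m + i)) m w = (1 + d) ^ m *\<^sub>R T (w + (s * (w \<bullet> y)) *\<^sub>R v)"
  proof -
    \<comment> \<open>The tilted first map is split off, so that the remaining \<open>m'\<close>
      maps are pure scalings of \<open>D\<close>.\<close>
    obtain m' where m': "m = Suc m'" using m by (cases m) auto
    have "comp_seq (\<lambda>i. L' (k * m + i)) m = comp_seq (\<lambda>i. L' (k * m + (1 + i))) m' \<circ> L' (k * m)"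
      using comp_seq_add[of "\<lambda>i. L' (k * m + i)" 1 m'] m' by simp
    also have "comp_seq (\<lambda>i. L' (k * m + (1 + i))) m'
        = comp_seq (\<lambda>i z. (1 + d) *\<^sub>R D (k * m + (1 + i)) z) m'"
      by (rule comp_seq_cong) (auto simp: L'_def m')
    finally have "comp_seq (\<lambda>i. L' (k * m + i)) m w
        = (1 + d) ^ m' *\<^sub>R comp_seq (\<lambda>i. D (k * m + (1 + i))) m' (L' (k * m) w)"
      by (simp add: comp_seq_scale lin)
    also have "L' (k * m) w = (1 + d) *\<^sub>R D (k * m) (w + (s * (w \<bullet> y)) *\<^sub>R v)"
      using m by (simp add: L'_def)
    also have "comp_seq (\<lambda>i. D (k * m + (1 + i))) m' ((1 + d) *\<^sub>R D (k * m) (w + (s * (w \<bullet> y)) *\<^sub>R v))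
        = (1 + d) *\<^sub>R T (w + (s * (w \<bullet> y)) *\<^sub>R v)"
      using comp_seq_add[of "\<lambda>i. D (k * m + i)" 1 m'] m'
      by (simp add: T_def linear_scale[OF linear_comp_seq, OF lin])
    finally show ?thesis by (simp add: m')
  qed
  have wy: "w \<bullet> y = norm w" "w = norm w *\<^sub>R y"
    using w0 by (auto simp: y_def power2_norm_eq_inner[symmetric] power2_eq_square)
  have "w + (s * (w \<bullet> y)) *\<^sub>R v = norm w *\<^sub>R (y + s *\<^sub>R v)"
    using wy by (simp add: scaleR_add_right mult.commute)
  then have "norm (comp_seq L' (Suc k * m) u) = (1 + d) ^ m * (norm w * norm (T (y + s *\<^sub>R v)))"
    using comp_seq_add[of L' "k * m" m] c1 c2 d
    by (simp add: add.commute w_def[symmetric] linear_scale[OF linT])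
  moreover have "(\<Prod>j<Suc k. d * (1 + d) ^ m * onorm (comp_seq (\<lambda>i. D (j * m + i)) m))
      \<le> norm w * (d * (1 + d) ^ m * onorm T)"
    unfolding T_def using ge d
    by (simp add: w_def[symmetric])
      (intro mult_right_mono mult_nonneg_nonneg onorm_pos_le
        linear_conv_bounded_linear[THEN iffD1] linear_comp_seq lin; simp)
  moreover have "(1 + d) ^ m * (norm w * (d * onorm T)) \<le> (1 + d) ^ m * (norm w * norm (T (y + s *\<^sub>R v)))"
    using s d by (intro mult_left_mono) auto
  ultimately have "(\<Prod>j<Suc k. d * (1 + d) ^ m * onorm (comp_seq (\<lambda>i. D (j * m + i)) m))
      \<le> norm (comp_seq L' (Suc k * m) u)" by (simp add: mult_ac)
  moreover have "\<forall>i\<ge>Suc k * m. L' i = D i" by (auto simp: L'_def)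
  ultimately show ?case using L'lin u by blast
qed

text \<open>A partial product that is maximal starts a run of factors whose products stay small; the lower
  bound on the factors makes this run long.\<close>

lemma pliss:
  fixes a :: "nat \<Rightarrow> real"
  assumes pos: "\<And>i. c \<le> 2 * a i" and c: "0 < c" and P: "(\<Prod>i<k. 4 * a i) \<le> K"
  obtains j where "j \<le> k" "\<And>l. j + l \<le> k \<Longrightarrow> (\<Prod>i<l. a (j + i)) \<le> (1/2) ^ l"
    "2 ^ k * c ^ (k - j) \<le> K"
proof -
  define P where "P l = (\<Prod>i<l. 2 * a i)" for l
  have a0: "a i > 0" for i using pos[of i] c by auto
  have Ppos: "P l > 0" for l unfolding P_def using a0 by (intro prod_pos) auto
  have split: "P (j + l) = P j * (2 ^ l * (\<Prod>i<l. a (j + i)))" for j l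
    by (induction l) (auto simp: P_def)
  \<comment> \<open>Maximality is used twice: against later indices it bounds every product of
    factors \<open>2 * a i\<close> starting at \<open>j\<close> by 1, and against index 0, where
    \<open>P 0 = 1\<close>, it gives \<open>P j\<close> at least 1.\<close>
  define j where "j = arg_min_on (\<lambda>i. - P i) {..k}"
  have j: "j \<le> k" "\<And>i. i \<le> k \<Longrightarrow> P i \<le> P j"
    using arg_min_if_finite[of "{..k}" "\<lambda>i. - P i"] unfolding j_def by (auto simp: not_less[symmetric])
  have "(\<Prod>i<l. a (j + i)) \<le> (1/2) ^ l" if "j + l \<le> k" for l
  proof -
    have "P j * (2 ^ l * (\<Prod>i<l. a (j + i))) \<le> P j * 1" using j(2)[OF that] split by simp
    then have "2 ^ l * (\<Prod>i<l. a (j + i)) \<le> 1" using Ppos[of j] by (simp only: mult_le_cancel_left_pos)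
    then show ?thesis by (simp add: power_one_over field_simps)
  qed
  moreover have "2 ^ k * c ^ (k - j) \<le> K"
  proof -
    have "c ^ (k - j) = (\<Prod>i<k - j. c)" by simp
    also have "\<dots> \<le> (\<Prod>i<k - j. 2 * a (j + i))" using pos c by (intro prod_mono) auto
    also have "\<dots> = 1 * (2 ^ (k - j) * (\<Prod>i<k - j. a (j + i)))" by (simp add: prod.distrib)
    also have "\<dots> \<le> P j * (2 ^ (k - j) * (\<Prod>i<k - j. a (j + i)))"
      using j(2)[of 0] a0 by (intro mult_right_mono mult_nonneg_nonneg prod_nonneg) (auto simp: P_def less_imp_le)
    also have "\<dots> = P k" using split[of j "k - j"] j(1) by simp
    finally have "2 ^ k * c ^ (k - j) \<le> 2 ^ k * P k" by simp
    also have "\<dots> = (\<Prod>i<k. 4 * a i)" unfolding P_def by (simp add: prod.distrib power_mult_distrib[symmetric])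
    finally show ?thesis using P by simp
  qed
  ultimately show thesis using that j(1) by blast
qed

text \<open>The growth of \<open>aligned_perturbation\<close> is capped by the robust bound, and
  \<open>pliss\<close> is applied to the numbers \<open>a j\<close>, twice the block norms. Thus
  \<open>8 = 4 * 2\<close>, with the 4 required by \<open>pliss\<close>. Every block norm is at
  least \<open>1 / B ^ m\<close>, which is the lower bound on the factors needed there.\<close>

lemma robust_bound_contraction:
  fixes D :: "nat \<Rightarrow> 'e::euclidean_space \<Rightarrow> 'e"
  assumes lin: "\<And>i. linear (D i)" and up: "\<And>i z. norm (D i z) \<le> B * norm z"
    and lo: "\<And>i z. norm z \<le> B * norm (D i z)"
    and B: "B \<ge> 1" and d: "0 < d" "d \<le> 1/2" "3 * B * d \<le> e"
    and m: "m > 0" "8 \<le> d * (1 + d) ^ m"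
    and robust: "\<And>L u. (\<And>i. i < n \<Longrightarrow> linear (L i) \<and> bij (L i) \<and> (\<forall>z. norm (L i z - D i z) \<le> e * norm z))
                   \<Longrightarrow> norm (comp_seq L n u) \<le> K * norm u"
  obtains j where "j \<le> n div m"
    "\<And>l. j + l \<le> n div m \<Longrightarrow> (\<Prod>i<l. 2 * onorm (comp_seq (\<lambda>i'. D ((j + i) * m + i')) m)) \<le> (1/2) ^ l"
    "2 ^ (n div m) * (1 / B ^ m) ^ (n div m - j) \<le> B ^ m * K"
proof -
  define k where "k = n div m"
  define a where "a j = 2 * onorm (comp_seq (\<lambda>i'. D (j * m + i')) m)" for j
  obtain L u where L: "\<And>i. linear (L i) \<and> bij (L i) \<and> (\<forall>z. norm (L i z - D i z) \<le> e * norm z)"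
    and LD: "\<And>i. k * m \<le> i \<Longrightarrow> L i = D i" and u: "norm u = 1"
    and ge: "(\<Prod>j<k. d * (1 + d) ^ m * onorm (comp_seq (\<lambda>i. D (j * m + i)) m)) \<le> norm (comp_seq L (k * m) u)"
    using aligned_perturbation[where D=D and k=k, OF lin up lo B d m(1)] by blast
  have bl: "bounded_linear (comp_seq (\<lambda>i'. D (j * m + i')) m)" for j
    by (intro linear_conv_bounded_linear[THEN iffD1] linear_comp_seq lin)
  have pos: "onorm (comp_seq (\<lambda>i'. D (j * m + i')) m) \<ge> 1 / B ^ m" for j
  proof -
    obtain v :: 'e where v: "norm v = 1" using vector_choose_size[of 1] by auto
    have "1 \<le> B ^ m * norm (comp_seq (\<lambda>i'. D (j * m + i')) m v)"
      using comp_seq_norm_ge[of B "\<lambda>i'. D (j * m + i')" v m] lo B v by auto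
    also have "\<dots> \<le> B ^ m * onorm (comp_seq (\<lambda>i'. D (j * m + i')) m)"
      using onorm[OF bl[of j], of v] v B by (intro mult_left_mono) auto
    finally show ?thesis using B by (simp add: field_simps)
  qed
  have Bm: "0 < 1 / B ^ m" using B by simp
  have "(\<Prod>j<k. 4 * a j) \<le> (\<Prod>j<k. d * (1 + d) ^ m * onorm (comp_seq (\<lambda>i. D (j * m + i)) m))"
  proof (intro prod_mono conjI)
    fix j
    have nn: "0 \<le> onorm (comp_seq (\<lambda>i'. D (j * m + i')) m)" by (rule onorm_pos_le[OF bl])
    then show "0 \<le> 4 * a j" by (simp add: a_def)
    show "4 * a j \<le> d * (1 + d) ^ m * onorm (comp_seq (\<lambda>i. D (j * m + i)) m)"
      using mult_right_mono[OF m(2) nn] by (simp add: a_def)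
  qed
  also note ge
  \<comment> \<open>The last \<open>n mod m\<close> maps form no full block. They are unperturbed
    and lose at most a factor \<open>B\<close> each, whence the \<open>B ^ m\<close> in the
    conclusion.\<close>
  also have "norm (comp_seq L (k * m) u) \<le> B ^ (n mod m) * norm (comp_seq L (k * m + n mod m) u)"
    using comp_seq_norm_ge[of B "\<lambda>i. L (k * m + i)" "comp_seq L (k * m) u" "n mod m"] lo B LD
    by (simp add: comp_seq_add)
  also have "k * m + n mod m = n" by (simp add: k_def)
  also have "B ^ (n mod m) * norm (comp_seq L n u) \<le> B ^ m * K"
  proof (intro mult_mono power_increasing)
    show "norm (comp_seq L n u) \<le> K" using robust[of L u] L u by simp
  qed (use B m(1) in \<open>auto intro: less_imp_le\<close>)
  finally have P: "(\<Prod>j<k. 4 * a j) \<le> B ^ m * K" .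
  have "1 / B ^ m \<le> 2 * a j" for j unfolding a_def using pos[of j] Bm by linarith
  from pliss[OF this Bm P] show thesis
    using that unfolding a_def k_def by blast
qed

section \<open>Shrinking open sets and nonwandering points\<close>

text \<open>Compact Hausdorff spaces are regular. The closed set \<open>M - O'\<close> lies between
  \<open>N\<close> and \<open>W\<close>, and so plays the role of a closed ball around
  \<open>q\<close> inside \<open>W\<close>.\<close>

lemma compact_T2_separation:
  fixes M :: "'a::t2_space set"
  assumes "compact M" "openin (top_of_set M) W" "q \<in> W"
  obtains N O' where "openin (top_of_set M) N" "openin (top_of_set M) O'" "q \<in> N" "N \<inter> O' = {}"
    "M - O' \<subseteq> W" "N \<subseteq> W"
proof -
  have "Hausdorff_space (euclidean :: 'a topology)"
    unfolding Hausdorff_space_def disjnt_def by (metis hausdorff open_openin)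
  then have "regular_space (top_of_set M)"
    using assms(1) by (intro compact_Hausdorff_imp_regular_space Hausdorff_space_subtopology)
      (simp_all add: compact_space_subtopology)
  moreover have "closedin (top_of_set M) (M - W)"
    using openin_closedin_eq[of "top_of_set M" W] assms(2) by simp
  moreover have "q \<in> M - (M - W)" using assms openin_subset[OF assms(2)] by auto
  ultimately obtain N O' where N: "openin (top_of_set M) N" "openin (top_of_set M) O'" "q \<in> N" "M - W \<subseteq> O'" "disjnt N O'"
    unfolding regular_space_def topspace_euclidean_subtopology by metis
  have "N \<subseteq> M" using openin_subset[OF N(1)] by simp
  then show thesis using that[of N O'] N by (auto simp: disjnt_def)
qed

lemma openin_delete_finite:
  fixes M :: "'a::t1_space set"
  assumes "finite F"
  shows "openin (top_of_set M) (M - F)"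
  using assms by (metis Diff_eq finite_imp_closed open_Compl openin_open_Int)

lemma funpow_image_subset:
  assumes "f ` M \<subseteq> M" shows "(f ^^ n) ` M \<subseteq> M"
  using assms by (induction n) auto

lemma continuous_on_funpow:
  assumes "continuous_on M f" "f ` M \<subseteq> M"
  shows "continuous_on M (f ^^ n)"
proof (induction n)
  case (Suc n)
  then have "continuous_on M (f \<circ> (f ^^ n))"
    using funpow_image_subset[OF assms(2), of n] assms(1)
    by (intro continuous_on_compose) (auto intro: continuous_on_subset)
  then show ?case by simp
qed auto

text \<open>For each time \<open>t\<close> in \<open>{1..T}\<close>, continuity and
  \<open>f ^^ t\<close> moving \<open>q\<close> give a neighbourhood of \<open>q\<close> disjoint
  from its image under \<open>f ^^ t\<close>. A return to the intersection of these finitely many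
  neighbourhoods must be later than \<open>T\<close>.\<close>

lemma nonperiodic_late_return:
  fixes M :: "'a::t2_space set"
  assumes cont: "continuous_on M f" and fM: "f ` M \<subseteq> M"
    and q: "q \<in> nonwandering_set M f" and np: "\<And>t. t \<ge> 1 \<Longrightarrow> (f ^^ t) q \<noteq> q"
    and U: "openin (top_of_set M) U" "q \<in> U"
  obtains t x where "t \<ge> T" "t \<ge> 1" "x \<in> U" "(f ^^ t) x \<in> U"
proof -
  have qM: "q \<in> M" using q by (simp add: nonwandering_set_def)
  have "\<exists>V. openin (top_of_set M) V \<and> q \<in> V \<and> (f ^^ t) ` V \<inter> V = {}" if "t \<ge> 1" for t
  proof -
    obtain P Q where PQ: "open P" "open Q" "(f ^^ t) q \<in> P" "q \<in> Q" "P \<inter> Q = {}"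
      using hausdorff[OF np[OF \<open>t \<ge> 1\<close>]] by metis
    have "openin (top_of_set M) (M \<inter> (f ^^ t) -` P)"
      by (rule continuous_openin_preimage_gen[OF continuous_on_funpow[OF cont fM] PQ(1)])
    then have "openin (top_of_set M) ((M \<inter> (f ^^ t) -` P) \<inter> Q)"
      by (rule openin_Int_open) (rule PQ(2))
    then show ?thesis using PQ qM by (intro exI[of _ "(M \<inter> (f ^^ t) -` P) \<inter> Q"]) auto
  qed
  then obtain V where V: "\<And>t. t \<ge> 1 \<Longrightarrow> openin (top_of_set M) (V t) \<and> q \<in> V t \<and> (f ^^ t) ` V t \<inter> V t = {}"
    by metis
  define U' where "U' = U \<inter> (\<Inter>t\<in>{1..T}. V t \<inter> M)"
  have "U' = \<Inter> (insert U (V ` {1..T}))" using V openin_subset U by (fastforce simp: U'_def)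
  moreover have "openin (top_of_set M) (\<Inter> (insert U (V ` {1..T})))"
    by (rule openin_Inter) (use U V in auto)
  ultimately have "openin (top_of_set M) U'" "q \<in> U'" using U V qM by (auto simp: U'_def)
  then have "U' \<inter> (\<Union>n\<in>{1..}. (f ^^ n) ` U') \<noteq> {}"
    using q unfolding nonwandering_set_def wandering_def by blast
  then obtain t x where t: "t \<ge> 1" "x \<in> U'" "(f ^^ t) x \<in> U'" by auto
  have "\<not> t \<le> T"
  proof
    assume "t \<le> T"
    then have "x \<in> V t" "(f ^^ t) x \<in> V t" using t by (auto simp: U'_def)
    then show False using V[OF t(1)] by blast
  qed
  then show thesis using that[of t x] t by (auto simp: U'_def)
qed

text \<open>The hypothesis \<open>shrink\<close> says without a distance that the images of
  \<open>W\<close> become small. If \<open>q\<close> were not periodic, a late return would make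
  some \<open>h = f ^^ t\<close> map \<open>W\<close> into itself, with a fixed point
  \<open>x\<close> that attracts \<open>W\<close>. Late images of \<open>W\<close> then stay near
  the orbit of \<open>x\<close>, away from \<open>q\<close>, against another late return of
  \<open>q\<close>.\<close>

lemma shrinking_nonwandering_periodic:
  fixes M :: "'a::t2_space set"
  assumes M: "compact M" and cont: "continuous_on M f" and fM: "f ` M \<subseteq> M"
    and W: "openin (top_of_set M) W"
    and shrink: "\<And>U V. openin (top_of_set M) U \<Longrightarrow> openin (top_of_set M) V \<Longrightarrow> U \<union> V = M \<Longrightarrow>
                   \<exists>T. \<forall>t\<ge>T. (f ^^ t) ` W \<subseteq> U \<or> (f ^^ t) ` W \<subseteq> V"
    and q: "q \<in> W" "q \<in> nonwandering_set M f"
  obtains t where "t \<ge> 1" "(f ^^ t) q = q"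
proof (rule ccontr)
  assume "\<not> thesis"
  then have np: "\<And>t. t \<ge> 1 \<Longrightarrow> (f ^^ t) q \<noteq> q" using that by blast
  note late = nonperiodic_late_return[OF cont fM q(2) np]
  have WM: "W \<subseteq> M" using openin_subset[OF W] by simp
  obtain V O2 where V: "openin (top_of_set M) V" "openin (top_of_set M) O2" "q \<in> V" "V \<inter> O2 = {}" "M - O2 \<subseteq> W" "V \<subseteq> W"
    using compact_T2_separation[OF M W q(1)] .
  obtain N O1 where N: "openin (top_of_set M) N" "openin (top_of_set M) O1" "q \<in> N" "N \<inter> O1 = {}" "M - O1 \<subseteq> V" "N \<subseteq> V"
    using compact_T2_separation[OF M V(1,3)] .
  have VM: "V \<subseteq> M" using V(6) WM by auto
  \<comment> \<open>The chain is \<open>N\<close>, \<open>V\<close>, \<open>K\<close>,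
    \<open>W\<close>, each contained in the next. \<open>V\<close> is open, as the covers in
    \<open>shrink\<close> require, while \<open>K\<close> is compact, as the nested intersection
    requires.\<close>
  define K where "K = M - O2"
  have VK: "V \<subseteq> K" using V VM by (auto simp: K_def)
  have KW: "K \<subseteq> W" using V by (simp add: K_def)
  have "V \<union> O1 = M" using N(5) VM openin_subset[OF N(2)] by auto
  then obtain T where T: "\<And>t. t \<ge> T \<Longrightarrow> (f ^^ t) ` W \<subseteq> V \<or> (f ^^ t) ` W \<subseteq> O1"
    using shrink[OF V(1) N(2)] by blast
  obtain t x0 where t: "t \<ge> T" "t \<ge> 1" "x0 \<in> N" "(f ^^ t) x0 \<in> N"
    using late[OF _ N(1,3)] .
  define h where "h = f ^^ t"
  \<comment> \<open>The image of \<open>W\<close> contains the point \<open>(f ^^ t) x0\<close> of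
    \<open>N\<close>, which is disjoint from \<open>O1\<close>; so the cover by \<open>V\<close> and
    \<open>O1\<close> leaves only \<open>V\<close>.\<close>
  have hW: "h ` W \<subseteq> V"
    using T[OF t(1)] t(3,4) N V unfolding h_def by blast
  have hk: "h ^^ k = f ^^ (t * k)" for k unfolding h_def by (simp add: funpow_mult)
  define F where "F k = (h ^^ k) ` K" for k
  have hKK: "h ` K \<subseteq> K" using hW KW VK by blast
  have Fsuc: "F (Suc k) \<subseteq> F k" for k
  proof -
    have "F (Suc k) = (h ^^ k) ` (h ` K)" by (simp only: F_def funpow_Suc_right image_comp)
    also have "\<dots> \<subseteq> F k" using hKK by (auto simp: F_def)
    finally show ?thesis .
  qed
  have Fmono: "F k \<subseteq> F l" if "l \<le> k" for k l
    using that by (induction rule: dec_induct) (use Fsuc in blast)+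
  have "compact K"
    unfolding K_def using M V(2) by (metis closedin_compact closedin_diff closedin_topspace topspace_euclidean_subtopology)
  moreover have "continuous_on K (h ^^ k)" for k
    unfolding hk by (rule continuous_on_subset[OF continuous_on_funpow[OF cont fM]]) (use KW WM in auto)
  ultimately have Fc: "compact (F k)" for k unfolding F_def by (intro compact_continuous_image)
  have Fne: "F k \<noteq> {}" for k using V(3) VK by (auto simp: F_def)
  have "F 0 \<inter> \<Inter> (range F) \<noteq> {}"
  proof (rule compact_imp_fip[OF Fc])
    show "closed S" if "S \<in> range F" for S using that Fc compact_imp_closed by auto
    fix FF assume FF: "finite FF" "FF \<subseteq> range F"
    then obtain I where I: "finite I" "FF = F ` I" by (meson finite_subset_image)
    have "F (Max (insert 0 I)) \<subseteq> F 0 \<inter> \<Inter> FF"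
      unfolding I using I(1) by (intro Int_greatest INT_greatest Fmono) auto
    then show "F 0 \<inter> \<Inter> FF \<noteq> {}" using Fne by blast
  qed
  then obtain x where x: "\<And>k. x \<in> F k" by auto
  have xK: "x \<in> K" using x[of 0] by (simp add: F_def)
  then have xM: "x \<in> M" using KW WM by auto
  have fsW: "y \<in> (f ^^ (t * k)) ` W" if "y \<in> F k" for y k
    using that KW unfolding F_def hk by auto
  \<comment> \<open>Both \<open>x\<close> and \<open>h x\<close> lie in every \<open>F k\<close>,
    hence in images of \<open>W\<close> at arbitrarily late times. If they were distinct, the
    complements of the two points would form a cover contradicting \<open>shrink\<close>.\<close>
  have "h x = x"
  proof (rule ccontr)
    assume ne: "h x \<noteq> x"
    have "(M - {x}) \<union> (M - {h x}) = M" using ne by auto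
    then obtain T' where T': "\<And>s. s \<ge> T' \<Longrightarrow> (f ^^ s) ` W \<subseteq> M - {x} \<or> (f ^^ s) ` W \<subseteq> M - {h x}"
      using shrink[OF openin_delete_finite openin_delete_finite, of "{x}" "{h x}"] by auto
    have "t * T' \<ge> T'" using t(2) by simp
    moreover have "h x \<in> F (Suc T')" using x[of T'] by (auto simp: F_def)
    then have "h x \<in> F T'" using Fsuc by blast
    ultimately show False using T'[of "t * T'"] fsW x[of T'] by blast
  qed
  then have tx: "(f ^^ t) x = x" by (simp add: h_def)
  define X where "X = (\<lambda>i. (f ^^ i) x) ` {..<t}"
  have fX: "(f ^^ s) x \<in> X" for s
    unfolding X_def using t(2) funpow_mod_eq[OF tx, of s]
    by (intro image_eqI[of _ _ "s mod t"]) auto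
  have "q \<notin> X"
  proof
    assume "q \<in> X"
    then obtain i where "q = (f ^^ i) x" by (auto simp: X_def)
    then have "(f ^^ t) q = q" using tx by (metis add.commute comp_apply funpow_add)
    then show False using np[OF t(2)] by blast
  qed
  then have "q \<in> M - X" using q(1) WM by auto
  moreover have oX: "openin (top_of_set M) (M - X)" by (rule openin_delete_finite) (simp add: X_def)
  ultimately obtain N2 O3 where N2: "openin (top_of_set M) N2" "openin (top_of_set M) O3" "q \<in> N2" "N2 \<inter> O3 = {}" "M - O3 \<subseteq> M - X" "N2 \<subseteq> M - X"
    using compact_T2_separation[OF M] by metis
  have "X \<subseteq> M" using funpow_image_subset[OF fM] xM by (auto simp: X_def)
  then have "O3 \<union> (M - X) = M" using N2(5) openin_subset[OF N2(2)] by auto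
  then obtain T3 where T3: "\<And>s. s \<ge> T3 \<Longrightarrow> (f ^^ s) ` W \<subseteq> O3 \<or> (f ^^ s) ` W \<subseteq> M - X"
    using shrink[OF N2(2) oX] by blast
  \<comment> \<open>The image of \<open>W\<close> at time \<open>s\<close> contains the point
    \<open>(f ^^ s) x\<close> of \<open>X\<close>, so it must lie in \<open>O3\<close>; but the
    return of \<open>y\<close> puts a point of it into \<open>N2\<close>, which is disjoint from
    \<open>O3\<close>.\<close>
  obtain s y where s: "s \<ge> T3" "y \<in> N2 \<inter> W" "(f ^^ s) y \<in> N2 \<inter> W"
    using late[OF _ openin_Int[OF N2(1) W]] N2(3) q(1) by blast
  have "(f ^^ s) x \<in> (f ^^ s) ` W" using xK KW by auto
  then have "(f ^^ s) ` W \<subseteq> O3" using T3[OF s(1)] fX[of s] by blast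
  then show False using s(2,3) N2(4) by blast
qed

text \<open>Both points are periodic. At a common multiple of their periods both lie in the image of
  \<open>W\<close>, which the complements of the two points forbid at late times.\<close>

lemma shrinking_nonwandering_unique:
  fixes M :: "'a::t2_space set"
  assumes M: "compact M" and cont: "continuous_on M f" and fM: "f ` M \<subseteq> M"
    and W: "openin (top_of_set M) W"
    and shrink: "\<And>U V. openin (top_of_set M) U \<Longrightarrow> openin (top_of_set M) V \<Longrightarrow> U \<union> V = M \<Longrightarrow>
                   \<exists>T. \<forall>t\<ge>T. (f ^^ t) ` W \<subseteq> U \<or> (f ^^ t) ` W \<subseteq> V"
    and q: "q \<in> W" "q \<in> nonwandering_set M f" and r: "r \<in> W" "r \<in> nonwandering_set M f"
  shows "q = r"
proof (rule ccontr)
  assume "q \<noteq> r"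
  obtain t where t: "t \<ge> 1" "(f ^^ t) q = q" using shrinking_nonwandering_periodic[OF assms(1-5) q] .
  obtain s where s: "s \<ge> 1" "(f ^^ s) r = r" using shrinking_nonwandering_periodic[OF assms(1-5) r] .
  have "(M - {q}) \<union> (M - {r}) = M" using \<open>q \<noteq> r\<close> by auto
  then obtain T where T: "\<And>k. k \<ge> T \<Longrightarrow> (f ^^ k) ` W \<subseteq> M - {q} \<or> (f ^^ k) ` W \<subseteq> M - {r}"
    using shrink[OF openin_delete_finite openin_delete_finite, of "{q}" "{r}"] by auto
  have "(f ^^ (t * s * T)) q = q" using funpow_mod_eq[OF t(2), of "t * s * T"] by simp
  then have "q \<in> (f ^^ (t * s * T)) ` W" using q(1) by (intro image_eqI[of _ _ q]) auto
  moreover have "(f ^^ (t * s * T)) r = r" using funpow_mod_eq[OF s(2), of "t * s * T"] by simp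
  then have "r \<in> (f ^^ (t * s * T)) ` W" using r(1) by (intro image_eqI[of _ _ r]) auto
  moreover have "T \<le> t * s * T" using t s by simp
  ultimately show False using T[of "t * s * T"] by blast
qed

text \<open>By injectivity, a point that reaches the periodic point \<open>q\<close> already lies on
  the orbit of \<open>q\<close>.\<close>

lemma preperiodic_finite:
  assumes "inj_on f M" "f ` M \<subseteq> M" "q \<in> M" "t \<ge> 1" "(f ^^ t) q = q"
  shows "finite {p \<in> M. \<exists>i. (f ^^ i) p = q}"
proof (rule finite_subset)
  show "{p \<in> M. \<exists>i. (f ^^ i) p = q} \<subseteq> (\<lambda>i. (f ^^ i) q) ` {..<t}"
  proof
    fix p assume "p \<in> {p \<in> M. \<exists>i. (f ^^ i) p = q}"
    then obtain i where p: "p \<in> M" "q = (f ^^ i) p" by auto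
    have inj: "inj_on (f ^^ i) M" 
    proof (induction i)
      case (Suc i) then show ?case
        using assms(1) funpow_image_subset[OF assms(2), of i]
        by (simp only: funpow.simps) (intro comp_inj_on, auto intro: inj_on_subset)
    qed auto
    \<comment> \<open>This makes the natural subtraction \<open>t * i - i\<close> exact. Both
      \<open>p\<close> and \<open>(f ^^ (t * i - i)) q\<close> are then preimages of
      \<open>q\<close> under \<open>f ^^ i\<close>.\<close>
    have "i \<le> t * i" using assms(4) by (cases t) auto
    then have "(f ^^ i) ((f ^^ (t * i - i)) q) = (f ^^ (t * i)) q"
      using funpow_add[of i "t * i - i" f] by simp
    also have "\<dots> = (f ^^ i) p" using funpow_mod_eq[OF assms(5), of "t * i"] p by simp
    finally have "(f ^^ (t * i - i)) q = p"
      using inj p(1) assms(3) funpow_image_subset[OF assms(2), of "t * i - i"]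
      by (intro inj_onD[OF inj, of "(f ^^ (t * i - i)) q" p]) auto
    then have "p = (f ^^ ((t * i - i) mod t)) q" using funpow_mod_eq[OF assms(5), of "t * i - i"] by simp
    then show "p \<in> (\<lambda>i. (f ^^ i) q) ` {..<t}"
      using assms(4) by (intro image_eqI[of _ _ "(t * i - i) mod t"]) auto
  qed
qed auto

text \<open>The contracting points are iterates of points of \<open>S\<close>, so they inherit being
  nonwandering. A return to the preimage of \<open>U\<close> is carried by \<open>f\<close> to a
  return to \<open>U\<close>.\<close>

lemma nonwandering_set_invariant:
  fixes M :: "'a::topological_space set"
  assumes cont: "continuous_on M f" and fM: "f ` M \<subseteq> M" and x: "x \<in> nonwandering_set M f"
  shows "(f ^^ n) x \<in> nonwandering_set M f"
proof (induction n)
  case (Suc n)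
  define y where "y = (f ^^ n) x"
  have y: "y \<in> M" "\<not> wandering M f y" using Suc by (auto simp: y_def nonwandering_set_def)
  have "\<not> wandering M f (f y)"
    unfolding wandering_def
  proof safe
    fix U assume U: "openin (top_of_set M) U" "f y \<in> U" and dis: "U \<inter> (\<Union>n\<in>{1..}. (f ^^ n) ` U) = {}"
    have "openin (top_of_set M) (M \<inter> f -` U)"
      using continuous_openin_preimage[OF cont _ U(1)] fM by auto
    then have "(M \<inter> f -` U) \<inter> (\<Union>n\<in>{1..}. (f ^^ n) ` (M \<inter> f -` U)) \<noteq> {}"
      using y U(2) unfolding wandering_def by blast
    then obtain k z where k: "k \<in> {1..}" "f z \<in> U" "f ((f ^^ k) z) \<in> U" by auto
    have "(f ^^ k) (f z) \<in> U" using k(3) funpow_swap1[of f k z] by (rule back_subst)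
    then have "(f ^^ k) (f z) \<in> U \<inter> (\<Union>n\<in>{1..}. (f ^^ n) ` U)"
      by (rule IntI) (rule UN_I[OF k(1)], rule imageI, rule k(2))
    with dis show False by (simp only: empty_iff)
  qed
  then show ?case using y fM by (auto simp: nonwandering_set_def y_def)
qed (use x in simp)

section \<open>Uniform differentiability in charts\<close>

lemma finite_uniform_pos:
  assumes "finite I" "\<And>i. i \<in> I \<Longrightarrow> \<exists>r>0. P i r"
    and "\<And>i r r'. P i r \<Longrightarrow> 0 < r' \<Longrightarrow> r' \<le> r \<Longrightarrow> P i (r' :: real)"
  shows "\<exists>r>0. \<forall>i\<in>I. P i r"
  using assms(1,2)
proof (induction I)
  case (insert i I)
  obtain r where "r > 0" "\<forall>i\<in>I. P i r" using insert by auto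
  moreover obtain s where "s > 0" "P i s" using insert by blast
  ultimately show ?case using assms(3) by (intro exI[of _ "min r s"]) (auto; metis min.cobounded1 min.cobounded2 min_less_iff_conj)
qed (auto intro: exI[of _ 1])

lemma finite_uniform_bound:
  assumes "finite I" "\<And>i. i \<in> I \<Longrightarrow> \<exists>r. P i r"
    and "\<And>i r r'. P i r \<Longrightarrow> r \<le> r' \<Longrightarrow> P i (r' :: real)"
  shows "\<exists>r. \<forall>i\<in>I. P i r"
  using assms(1,2)
proof (induction I)
  case (insert i I)
  obtain r where "\<forall>i\<in>I. P i r" using insert by auto
  moreover obtain s where "P i s" using insert by blast
  ultimately show ?case using assms(3) by (intro exI[of _ "max r s"]) (auto; metis max.cobounded1 max.cobounded2)
qed auto

text \<open>\<open>Ck_on\<close> provides continuity of the derivative only in each fixed direction.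
  This estimate turns control in the finitely many basis directions into control of the operator
  norm.\<close>

lemma linear_norm_le_Basis:
  fixes L :: "'e::euclidean_space \<Rightarrow> 'b::real_normed_vector"
  assumes "linear L"
  shows "norm (L v) \<le> (\<Sum>b\<in>Basis. norm (L b)) * norm v"
proof -
  have "L v = L (\<Sum>b\<in>Basis. (v \<bullet> b) *\<^sub>R b)" by (simp add: euclidean_representation)
  also have "\<dots> = (\<Sum>b\<in>Basis. (v \<bullet> b) *\<^sub>R L b)"
    by (simp add: linear_sum[OF assms] linear_scale[OF assms])
  also have "norm \<dots> \<le> (\<Sum>b\<in>Basis. norm (L b) * norm v)"
    by (intro sum_norm_le) (use Basis_le_norm in \<open>auto intro!: mult_left_mono simp: mult.commute[of "\<bar>_\<bar>"]\<close>)
  finally show ?thesis by (simp add: sum_distrib_right)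
qed

lemma C1_has_derivative:
  assumes "Ck_on 1 h G" "x \<in> G"
  shows "(h has_derivative frechet_derivative h (at x)) (at x)"
  using assms by (auto simp: frechet_derivative_works)

lemma C1_derivative_bounded:
  fixes h :: "'e::euclidean_space \<Rightarrow> 'b::real_normed_vector"
  assumes h: "Ck_on 1 h G" and Z: "compact Z" "Z \<subseteq> G"
  shows "\<exists>B. \<forall>z\<in>Z. \<forall>v. norm (frechet_derivative h (at z) v) \<le> B * norm v"
proof -
  let ?d = "\<lambda>z b. frechet_derivative h (at z) b"
  have "continuous_on Z (\<lambda>z. \<Sum>b\<in>Basis. norm (?d z b))"
    by (intro continuous_intros continuous_on_subset[OF _ Z(2)]) (use h in auto)
  then have "bounded ((\<lambda>z. \<Sum>b\<in>Basis. norm (?d z b)) ` Z)"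
    using compact_continuous_image compact_imp_bounded Z(1) by blast
  then obtain B where B: "\<And>z. z \<in> Z \<Longrightarrow> (\<Sum>b\<in>Basis. norm (?d z b)) \<le> B"
    unfolding bounded_real by (auto simp: abs_le_iff)
  have "norm (?d z v) \<le> B * norm v" if "z \<in> Z" for z v
  proof -
    have "linear (?d z)" using C1_has_derivative[OF h] Z(2) that has_derivative_linear by blast
    from linear_norm_le_Basis[OF this, of v] mult_right_mono[OF B[OF that], of "norm v"]
    show ?thesis by simp
  qed
  then show ?thesis by blast
qed

text \<open>The derivative is uniformly continuous on a compact neighbourhood of \<open>Z\<close>,
  and the mean value inequality on a small ball bounds the linearization error by the oscillation of
  the derivative there.\<close>

lemma C1_uniformly_differentiable:
  fixes h :: "'e::euclidean_space \<Rightarrow> 'b::real_normed_vector"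
  assumes h: "Ck_on 1 h G" and G: "open G" and Z: "compact Z" "Z \<subseteq> G" and e: "e > 0"
  shows "\<exists>r>0. \<forall>z\<in>Z. \<forall>y. norm (y - z) \<le> r \<longrightarrow>
           y \<in> G \<and> norm (h y - h z - frechet_derivative h (at z) (y - z)) \<le> e * norm (y - z)"
proof -
  let ?d = "\<lambda>z. frechet_derivative h (at z)"
  obtain r0 where r0: "r0 > 0" "(\<Union>x\<in>Z. cball x r0) \<subseteq> G"
    using compact_subset_open_imp_cball_epsilon_subset[OF Z(1) G Z(2)] .
  \<comment> \<open>The balls around points of \<open>Z\<close> need not stay in \<open>Z\<close>.
    \<open>N\<close> is the closed \<open>r0\<close>-neighbourhood of \<open>Z\<close>, compact as a
    sum of compact sets.\<close>
  define N where "N = {x + y |x y. x \<in> Z \<and> y \<in> cball (0::'e) r0}"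
  have N: "compact N" unfolding N_def by (intro compact_sums Z) auto
  have inN: "y \<in> N" if "z \<in> Z" "norm (y - z) \<le> r0" for y z
    unfolding N_def using that by (intro CollectI exI[of _ z] exI[of _ "y - z"]) auto
  have NG: "N \<subseteq> G" unfolding N_def using r0(2) by (fastforce simp: dist_norm)
  \<comment> \<open>There are \<open>DIM('e)\<close> basis directions, each contributing at most
    \<open>e'\<close> to the operator norm.\<close>
  define e' where "e' = e / real DIM('e)"
  have e': "e' > 0" using e by (simp add: e'_def)
  have "\<exists>r>0. \<forall>b\<in>(Basis :: 'e set). \<forall>x\<in>N. \<forall>y\<in>N. dist y x < r \<longrightarrow> norm (?d y b - ?d x b) \<le> e'"
  proof (rule finite_uniform_pos)
    fix b :: 'e
    have "continuous_on N (\<lambda>z. ?d z b)" by (rule continuous_on_subset[OF _ NG]) (use h in auto)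
    then have "uniformly_continuous_on N (\<lambda>z. ?d z b)" using N compact_uniformly_continuous by blast
    then show "\<exists>r>0. \<forall>x\<in>N. \<forall>y\<in>N. dist y x < r \<longrightarrow> norm (?d y b - ?d x b) \<le> e'"
      unfolding uniformly_continuous_on_def using e' by (metis dist_norm less_imp_le)
  next
    fix b :: 'e and r r' :: real
    assume "\<forall>x\<in>N. \<forall>y\<in>N. dist y x < r \<longrightarrow> norm (?d y b - ?d x b) \<le> e'" "r' \<le> r"
    then show "\<forall>x\<in>N. \<forall>y\<in>N. dist y x < r' \<longrightarrow> norm (?d y b - ?d x b) \<le> e'" by fastforce
  qed auto
  then obtain r1 where r1: "r1 > 0" "\<And>b x y. b \<in> Basis \<Longrightarrow> x \<in> N \<Longrightarrow> y \<in> N \<Longrightarrow> dist y x < r1 \<Longrightarrow> norm (?d y b - ?d x b) \<le> e'"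
    by blast
  define r where "r = min r0 (r1 / 2)"
  have r: "r > 0" "r \<le> r0" "r < r1" using r0 r1 by (auto simp: r_def)
  have "y \<in> G \<and> norm (h y - h z - ?d z (y - z)) \<le> e * norm (y - z)" if z: "z \<in> Z" and y: "norm (y - z) \<le> r" for z y
  proof
    show "y \<in> G" using inN[OF z] y r NG by auto
    have lin: "linear (?d x)" if "x \<in> N" for x using C1_has_derivative[OF h] NG that has_derivative_linear by blast
    have zN: "z \<in> N" using inN[OF z, of z] r0 by simp
    have cb: "cball z r \<subseteq> N" using inN[OF z] r by (force simp: dist_norm norm_minus_commute)
    have "norm (h y - h z - ?d z (y - z)) \<le> norm (y - z) * e"
    proof (rule differentiable_bound_linearization[where S = "cball z r"])
      show "z + t *\<^sub>R (y - z) \<in> cball z r" if "t \<in> {0..1}" for t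
      proof -
        have "\<bar>t\<bar> * norm (y - z) \<le> 1 * r" using that y by (intro mult_mono) auto
        then show ?thesis by (simp add: dist_norm)
      qed
      show "(h has_derivative ?d x) (at x within cball z r)" if "x \<in> cball z r" for x
        using C1_has_derivative[OF h] that cb NG has_derivative_at_withinI by blast
      show "onorm (?d x - ?d z) \<le> e" if "x \<in> cball z r" for x
      proof (rule onorm_le)
        fix v :: 'e
        have xN: "x \<in> N" using that cb by blast
        have lin': "linear (?d x - ?d z)"
          using linear_compose_sub[OF lin[OF xN] lin[OF zN]] by (simp add: fun_diff_def)
        have "(\<Sum>b\<in>Basis. norm ((?d x - ?d z) b)) \<le> (\<Sum>b\<in>(Basis::'e set). e')"
          using r1(2)[OF _ zN xN] that r by (intro sum_mono) (auto simp: dist_commute)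
        also have "\<dots> = e" by (simp add: e'_def)
        finally have "(\<Sum>b\<in>Basis. norm ((?d x - ?d z) b)) * norm v \<le> e * norm v" by (intro mult_right_mono) auto
        then show "norm ((?d x - ?d z) v) \<le> e * norm v" using linear_norm_le_Basis[OF lin', of v] by linarith
      qed
      show "z \<in> cball z r" using r by simp
    qed
    then show "norm (h y - h z - ?d z (y - z)) \<le> e * norm (y - z)" by (simp add: mult.commute)
  qed
  then show ?thesis using r(1) by blast
qed

section \<open>Compact cores of charts and derivatives in chosen charts\<close>

lemma is_chartD:
  assumes "is_chart M c"
  shows "openin (top_of_set M) (chart_dom c)" "chart_dom c \<subseteq> M" "open (chart_map c ` chart_dom c)"
    "continuous_on (chart_dom c) (chart_map c)" "continuous_on (chart_map c ` chart_dom c) (chart_inv c)"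
    "\<And>x. x \<in> chart_dom c \<Longrightarrow> chart_inv c (chart_map c x) = x"
    "\<And>y. y \<in> chart_map c ` chart_dom c \<Longrightarrow> chart_map c (chart_inv c y) = y"
    "\<And>y. y \<in> chart_map c ` chart_dom c \<Longrightarrow> chart_inv c y \<in> chart_dom c"
  using assms openin_imp_subset unfolding is_chart_def homeomorphism_def by fastforce+

lemma chart_image_open:
  assumes c: "is_chart M c" and X: "openin (top_of_set M) X"
  shows "open (chart_map c ` (X \<inter> chart_dom c))"
proof -
  have "openin (top_of_set (chart_dom c)) (X \<inter> chart_dom c)"
    using openin_subset_trans[OF openin_Int[OF X is_chartD(1)[OF c]]] is_chartD(2)[OF c] by simp
  then have "openin (top_of_set (chart_map c ` chart_dom c)) (chart_map c ` (X \<inter> chart_dom c))"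
    using c homeomorphism_imp_open_map unfolding is_chart_def by blast
  then show ?thesis using is_chartD(3)[OF c] openin_open_eq by blast
qed

lemma chart_inv_image_openin:
  assumes c: "is_chart M c" and V: "open V" "V \<subseteq> chart_map c ` chart_dom c"
  shows "openin (top_of_set M) (chart_inv c ` V)"
proof -
  have "chart_inv c ` V = chart_dom c \<inter> chart_map c -` V"
    using is_chartD(6,7,8)[OF c] V(2) by (auto simp: image_iff) (metis)
  moreover have "openin (top_of_set (chart_dom c)) (chart_dom c \<inter> chart_map c -` V)"
    by (rule continuous_openin_preimage_gen[OF is_chartD(4)[OF c] V(1)])
  ultimately show ?thesis using openin_trans is_chartD(1)[OF c] by metis
qed

text \<open>Each point is the centre of a closed coordinate ball inside a chart image, and finitely
  many of the open balls cover \<open>M\<close>. The cores are compact although the chart images are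
  open, so continuous quantities are bounded on them.\<close>

lemma chart_cores:
  fixes M :: "'a::t2_space set" and A :: "('a, 'e::euclidean_space) chart set"
  assumes "closed_manifold M A"
  obtains C k where "finite C" "C \<subseteq> A" "\<And>c. c \<in> C \<Longrightarrow> compact (k c)"
    "\<And>c. c \<in> C \<Longrightarrow> k c \<subseteq> chart_map c ` chart_dom c"
    "\<And>q. q \<in> M \<Longrightarrow> \<exists>c\<in>C. q \<in> chart_dom c \<and> chart_map c q \<in> k c"
proof -
  have M: "compact M" and ch: "\<And>c. c \<in> A \<Longrightarrow> is_chart M c" and cov: "(\<Union>c\<in>A. chart_dom c) = M"
    using assms by (auto simp: closed_manifold_def smooth_atlas_def)
  have "\<exists>c r. c \<in> A \<and> q \<in> chart_dom c \<and> r > 0 \<and> cball (chart_map c q) r \<subseteq> chart_map c ` chart_dom c"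
    if "q \<in> M" for q
  proof -
    obtain c where c: "c \<in> A" "q \<in> chart_dom c" using cov \<open>q \<in> M\<close> by blast
    then show ?thesis using is_chartD(3)[OF ch] open_contains_cball by (metis imageI)
  qed
  then obtain c r where cr: "\<And>q. q \<in> M \<Longrightarrow> c q \<in> A \<and> q \<in> chart_dom (c q) \<and> r q > 0 \<and>
      cball (chart_map (c q) q) (r q) \<subseteq> chart_map (c q) ` chart_dom (c q)"
    by metis
  define N where "N q = chart_inv (c q) ` ball (chart_map (c q) q) (r q)" for q
  have oN: "openin (top_of_set M) (N q)" if "q \<in> M" for q
    unfolding N_def using cr[OF that] ch by (intro chart_inv_image_openin) (auto intro: order_trans[OF ball_subset_cball])
  have qN: "q \<in> N q" if "q \<in> M" for q
    unfolding N_def using cr[OF that] is_chartD(6)[OF ch] by (intro image_eqI[of _ _ "chart_map (c q) q"]) auto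
  have "\<exists>D\<subseteq>N ` M. finite D \<and> M \<subseteq> \<Union> D"
    using M[unfolded compact_eq_openin_cover] oN qN by (auto elim!: allE[of _ "N ` M"])
  then obtain Q where Q: "Q \<subseteq> M" "finite Q" "M \<subseteq> (\<Union>q\<in>Q. N q)"
    by (metis finite_subset_image)
  \<comment> \<open>Several centres may share a chart, so the core of a chart is the union of all
    its selected closed balls.\<close>
  define k where "k c' = (\<Union>q\<in>{q \<in> Q. c q = c'}. cball (chart_map c' q) (r q))" for c'
  show thesis
  proof (rule that[of "c ` Q" k])
    show "compact (k c')" for c' unfolding k_def using Q(2) by (intro compact_UN) auto
    show "k c' \<subseteq> chart_map c' ` chart_dom c'" for c' unfolding k_def using Q(1) cr by blast
    show "\<exists>c'\<in>c ` Q. p \<in> chart_dom c' \<and> chart_map c' p \<in> k c'" if "p \<in> M" for p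
    proof -
      obtain q where q: "q \<in> Q" "p \<in> N q" using Q(3) \<open>p \<in> M\<close> by blast
      then obtain y where y: "y \<in> ball (chart_map (c q) q) (r q)" "p = chart_inv (c q) y" by (auto simp: N_def)
      have yi: "y \<in> chart_map (c q) ` chart_dom (c q)" using y cr Q(1) q(1) ball_subset_cball by blast
      have ic: "is_chart M (c q)" using cr Q(1) q(1) ch by blast
      have "p \<in> chart_dom (c q)" "chart_map (c q) p = y" using is_chartD(7,8)[OF ic yi] y by auto
      moreover have "y \<in> k (c q)" unfolding k_def using y(1) q(1) by (auto intro!: bexI[of _ q])
      ultimately show ?thesis using q(1) by blast
    qed
  qed (use Q cr in auto)
qed

lemma smooth_on_differentiable:
  "smooth_on h X \<Longrightarrow> x \<in> X \<Longrightarrow> (h has_derivative frechet_derivative h (at x)) (at x)"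
  unfolding smooth_on_def by (blast intro: C1_has_derivative)

text \<open>The choice \<open>ch\<close> need not be continuous, so the coordinates of nearby points
  may belong to different charts. Uniform constants come from there being finitely many pairs of
  charts in \<open>C\<close>, with a compact set of relevant coordinates for each.\<close>

locale chart_cover =
  fixes M :: "'a::t2_space set" and A :: "('a, 'e::euclidean_space) chart set"
    and C :: "('a, 'e) chart set" and core :: "('a, 'e) chart \<Rightarrow> 'e set" and ch :: "'a \<Rightarrow> ('a, 'e) chart"
  assumes closed: "closed_manifold M A"
    and C: "finite C" "C \<subseteq> A"
    and core: "\<And>c. c \<in> C \<Longrightarrow> compact (core c)" "\<And>c. c \<in> C \<Longrightarrow> core c \<subseteq> chart_map c ` chart_dom c"
    and ch: "\<And>q. q \<in> M \<Longrightarrow> ch q \<in> C" "\<And>q. q \<in> M \<Longrightarrow> q \<in> chart_dom (ch q)"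
      "\<And>q. q \<in> M \<Longrightarrow> chart_map (ch q) q \<in> core (ch q)"
begin

definition pos :: "'a \<Rightarrow> 'e" where "pos q = chart_map (ch q) q"

definition loc :: "('a \<Rightarrow> 'a) \<Rightarrow> 'a \<Rightarrow> 'e \<Rightarrow> 'e" where
  "loc f q = chart_map (ch (f q)) \<circ> f \<circ> chart_inv (ch q)"

text \<open>The target coordinates are those chosen at \<open>f q\<close>. Consecutive factors along
  an orbit therefore match, and their \<open>comp_seq\<close> represents the derivative of the
  iterate.\<close>

definition der :: "('a \<Rightarrow> 'a) \<Rightarrow> 'a \<Rightarrow> 'e \<Rightarrow> 'e" where
  "der f q = frechet_derivative (loc f q) (at (pos q))"

lemma compact_M: "compact M"
  using closed by (simp add: closed_manifold_def)

lemma chart: "c \<in> A \<Longrightarrow> is_chart M c"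
  using closed by (auto simp: closed_manifold_def smooth_atlas_def)

lemma chC: "c \<in> C \<Longrightarrow> is_chart M c"
  using chart C by blast

lemma chM: "q \<in> M \<Longrightarrow> is_chart M (ch q)"
  using chC ch by blast

lemma chart_inv_pos: "q \<in> M \<Longrightarrow> chart_inv (ch q) (pos q) = q"
  using is_chartD(6)[OF chM] ch(2) by (simp add: pos_def)

lemma loc_pos: "q \<in> M \<Longrightarrow> loc f q (pos q) = pos (f q)"
  by (simp add: loc_def chart_inv_pos pos_def[of "f q"])

lemma core_radius:
  obtains r where "r > 0" "\<And>q. q \<in> M \<Longrightarrow> cball (pos q) r \<subseteq> chart_map (ch q) ` chart_dom (ch q)"
proof -
  have "\<exists>r>0. \<forall>c\<in>C. \<forall>y\<in>core c. cball y r \<subseteq> chart_map c ` chart_dom c"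
  proof (rule finite_uniform_pos[OF C(1)])
    fix c assume c: "c \<in> C"
    from compact_subset_open_imp_cball_epsilon_subset[OF core(1)[OF c] is_chartD(3)[OF chC[OF c]] core(2)[OF c]]
    show "\<exists>r>0. \<forall>y\<in>core c. cball y r \<subseteq> chart_map c ` chart_dom c" by (metis UN_subset_iff)
  next
    fix c and r r' :: real assume "\<forall>y\<in>core c. cball y r \<subseteq> chart_map c ` chart_dom c" "r' \<le> r"
    then show "\<forall>y\<in>core c. cball y r' \<subseteq> chart_map c ` chart_dom c" using subset_cball[of r' r] by blast
  qed
  then show thesis using that ch unfolding pos_def by blast
qed

lemma loc_domain_open:
  assumes f: "C1_map M A f" and c: "c \<in> A" "c' \<in> A"
  shows "open (chart_map c ` {x \<in> chart_dom c. f x \<in> chart_dom c'})"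
proof -
  have "openin (top_of_set M) (M \<inter> f -` chart_dom c')"
    using f continuous_openin_preimage[OF _ _ is_chartD(1)[OF chart[OF c(2)]]] by (auto simp: C1_map_def)
  from chart_image_open[OF chart[OF c(1)] this]
  have "open (chart_map c ` ((M \<inter> f -` chart_dom c') \<inter> chart_dom c))" .
  moreover have "(M \<inter> f -` chart_dom c') \<inter> chart_dom c = {x \<in> chart_dom c. f x \<in> chart_dom c'}"
    using is_chartD(2)[OF chart[OF c(1)]] by auto
  ultimately show ?thesis by simp
qed

text \<open>\<open>Z\<close> is the part of one core that \<open>f\<close> maps into the other; the
  second core gives a compact, hence closed, subset of the Hausdorff space. Every
  \<open>pos q\<close> lies in such a set for the pair \<open>ch q\<close>, \<open>ch (f q)\<close>,
  so a constant for each pair yields one for all \<open>q\<close>.\<close>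

lemma core_pair:
  assumes f: "C1_map M A f" and c: "c \<in> C" "c' \<in> C"
  defines "Z \<equiv> {y \<in> core c. f (chart_inv c y) \<in> chart_inv c' ` core c'}"
  shows "compact Z" "Z \<subseteq> chart_map c ` {x \<in> chart_dom c. f x \<in> chart_dom c'}"
proof -
  note D = is_chartD[OF chC[OF c(1)]] and D' = is_chartD[OF chC[OF c(2)]]
  have "compact (chart_inv c' ` core c')"
    using core[OF c(2)] D'(5) by (intro compact_continuous_image) (auto intro: continuous_on_subset)
  then have "closed (chart_inv c' ` core c')" by (rule compact_imp_closed)
  moreover have "continuous_on (core c) (f \<circ> chart_inv c)"
  proof (rule continuous_on_compose)
    show "continuous_on (core c) (chart_inv c)" using D(5) core(2)[OF c(1)] continuous_on_subset by blast
    have "chart_inv c ` core c \<subseteq> M" using D(2,8) core(2)[OF c(1)] by blast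
    then show "continuous_on (chart_inv c ` core c) f"
      using f continuous_on_subset unfolding C1_map_def by blast
  qed
  ultimately have "closedin (top_of_set (core c)) (core c \<inter> (f \<circ> chart_inv c) -` (chart_inv c' ` core c'))"
    by (intro continuous_closedin_preimage)
  moreover have "core c \<inter> (f \<circ> chart_inv c) -` (chart_inv c' ` core c') = Z" by (auto simp: Z_def)
  ultimately show "compact Z" using closedin_compact core(1)[OF c(1)] by metis
  show "Z \<subseteq> chart_map c ` {x \<in> chart_dom c. f x \<in> chart_dom c'}"
  proof
    fix y assume y: "y \<in> Z"
    then have yi: "y \<in> chart_map c ` chart_dom c" using core(2)[OF c(1)] by (auto simp: Z_def)
    obtain w where w: "w \<in> core c'" "f (chart_inv c y) = chart_inv c' w" using y unfolding Z_def by auto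
    have "f (chart_inv c y) \<in> chart_dom c'" unfolding w(2) using w(1) core(2)[OF c(2)] by (intro D'(8)) auto
    then show "y \<in> chart_map c ` {x \<in> chart_dom c. f x \<in> chart_dom c'}"
      using D(7,8)[OF yi] by (intro image_eqI[of _ _ "chart_inv c y"]) auto
  qed
qed

lemma pos_in_core_pair:
  assumes f: "C1_map M A f" and q: "q \<in> M"
  shows "f q \<in> M" "pos q \<in> {y \<in> core (ch q). f (chart_inv (ch q) y) \<in> chart_inv (ch (f q)) ` core (ch (f q))}"
proof -
  show fq: "f q \<in> M" using f q by (auto simp: C1_map_def)
  have "f q \<in> chart_inv (ch (f q)) ` core (ch (f q))"
    using chart_inv_pos[OF fq] ch(3)[OF fq] unfolding pos_def by (metis imageI)
  then show "pos q \<in> {y \<in> core (ch q). f (chart_inv (ch q) y) \<in> chart_inv (ch (f q)) ` core (ch (f q))}"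
    using ch(3)[OF q] chart_inv_pos[OF q] by (simp add: pos_def)
qed

lemma loc_has_derivative:
  assumes f: "C1_map M A f" and q: "q \<in> M"
  shows "(loc f q has_derivative der f q) (at (pos q))"
proof -
  note p = pos_in_core_pair[OF f q]
  have c: "ch q \<in> C" "ch (f q) \<in> C" using ch(1) q p(1) by auto
  have "Ck_on 1 (loc f q) (chart_map (ch q) ` {x \<in> chart_dom (ch q). f x \<in> chart_dom (ch (f q))})"
    using f c C(2) unfolding C1_map_def loc_def by blast
  then show ?thesis unfolding der_def
    using C1_has_derivative core_pair(2)[OF f c] p(2) by blast
qed

lemma linear_der: "C1_map M A f \<Longrightarrow> q \<in> M \<Longrightarrow> linear (der f q)"
  using loc_has_derivative has_derivative_linear by blast

lemma der_bounded:
  assumes f: "C1_map M A f"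
  shows "\<exists>B. \<forall>q\<in>M. \<forall>v. norm (der f q v) \<le> B * norm v"
proof -
  define h where "h c c' = chart_map c' \<circ> f \<circ> chart_inv c" for c c' :: "('a, 'e) chart"
  define Z where "Z c c' = {y \<in> core c. f (chart_inv c y) \<in> chart_inv c' ` core c'}" for c c'
  define P where "P cc B \<longleftrightarrow> (\<forall>z\<in>Z (fst cc) (snd cc). \<forall>v.
      norm (frechet_derivative (h (fst cc) (snd cc)) (at z) v) \<le> B * norm v)" for cc and B :: real
  have "\<exists>B. \<forall>cc\<in>C \<times> C. P cc B"
  proof (rule finite_uniform_bound)
    fix cc assume "cc \<in> C \<times> C"
    then have c: "fst cc \<in> C" "snd cc \<in> C" by auto
    have "Ck_on 1 (h (fst cc) (snd cc))
        (chart_map (fst cc) ` {x \<in> chart_dom (fst cc). f x \<in> chart_dom (snd cc)})"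
      using f c C(2) unfolding C1_map_def h_def by blast
    from C1_derivative_bounded[OF this core_pair[OF f c]]
    show "\<exists>B. P cc B" by (simp add: P_def Z_def)
  next
    show "P cc r'" if "P cc r" "r \<le> r'" for cc r r'
      using that(1) mult_right_mono[OF that(2) norm_ge_zero] unfolding P_def by (meson order_trans)
  qed (use C in auto)
  then obtain B where PB: "\<And>cc. cc \<in> C \<times> C \<Longrightarrow> P cc B" by blast
  have B: "norm (frechet_derivative (h c c') (at z) v) \<le> B * norm v"
    if "c \<in> C" "c' \<in> C" "z \<in> Z c c'" for c c' z v
    using PB[of "(c, c')"] that by (simp add: P_def)
  have "norm (der f q v) \<le> B * norm v" if "q \<in> M" for q v
    using B[of "ch q" "ch (f q)" "pos q" v] pos_in_core_pair[OF f that] ch(1) that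
    by (simp add: der_def loc_def h_def Z_def)
  then show ?thesis by blast
qed

lemma loc_uniformly_differentiable:
  assumes f: "C1_map M A f" and e: "e > 0"
  shows "\<exists>r>0. \<forall>q\<in>M. \<forall>y. norm (y - pos q) \<le> r \<longrightarrow>
           y \<in> chart_map (ch q) ` chart_dom (ch q) \<and> f (chart_inv (ch q) y) \<in> chart_dom (ch (f q)) \<and>
           norm (loc f q y - pos (f q) - der f q (y - pos q)) \<le> e * norm (y - pos q)"
proof -
  define h where "h c c' = chart_map c' \<circ> f \<circ> chart_inv c" for c c' :: "('a, 'e) chart"
  define Z where "Z c c' = {y \<in> core c. f (chart_inv c y) \<in> chart_inv c' ` core c'}" for c c'
  define G where "G c c' = chart_map c ` {x \<in> chart_dom c. f x \<in> chart_dom c'}" for c c' :: "('a, 'e) chart"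
  define P where "P cc r \<longleftrightarrow> (\<forall>z\<in>Z (fst cc) (snd cc). \<forall>y. norm (y - z) \<le> r \<longrightarrow> y \<in> G (fst cc) (snd cc) \<and>
      norm (h (fst cc) (snd cc) y - h (fst cc) (snd cc) z - frechet_derivative (h (fst cc) (snd cc)) (at z) (y - z))
        \<le> e * norm (y - z))" for cc and r :: real
  have "\<exists>r>0. \<forall>cc\<in>C \<times> C. P cc r"
  proof (rule finite_uniform_pos)
    fix cc assume "cc \<in> C \<times> C"
    then have c: "fst cc \<in> C" "snd cc \<in> C" by auto
    then have c': "fst cc \<in> A" "snd cc \<in> A" using C by auto
    have "Ck_on 1 (h (fst cc) (snd cc)) (G (fst cc) (snd cc))"
      using f c' unfolding C1_map_def h_def G_def by blast
    from C1_uniformly_differentiable[OF this loc_domain_open[OF f c', folded G_def] core_pair[OF f c, folded G_def Z_def] e]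
    show "\<exists>r>0. P cc r" unfolding P_def .
  next
    show "P cc r'" if "P cc r" "r' \<le> r" for cc r r' using that unfolding P_def by (meson order_trans)
  qed (use C in auto)
  then obtain r where r: "r > 0" "\<And>cc. cc \<in> C \<times> C \<Longrightarrow> P cc r" by blast
  have "y \<in> chart_map (ch q) ` chart_dom (ch q) \<and> f (chart_inv (ch q) y) \<in> chart_dom (ch (f q)) \<and>
           norm (loc f q y - pos (f q) - der f q (y - pos q)) \<le> e * norm (y - pos q)"
    if q: "q \<in> M" and y: "norm (y - pos q) \<le> r" for q y
  proof -
    have "(ch q, ch (f q)) \<in> C \<times> C" using ch(1) q pos_in_core_pair(1)[OF f q] by auto
    from r(2)[OF this] have "y \<in> G (ch q) (ch (f q))"
      and "norm (h (ch q) (ch (f q)) y - h (ch q) (ch (f q)) (pos q) - frechet_derivative (h (ch q) (ch (f q))) (at (pos q)) (y - pos q))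
        \<le> e * norm (y - pos q)"
      using pos_in_core_pair(2)[OF f q] y unfolding P_def Z_def by auto
    moreover have "loc f q = h (ch q) (ch (f q))" by (simp add: loc_def h_def)
    ultimately show ?thesis
      using loc_pos[OF q, of f] is_chartD(6)[OF chM[OF q]] unfolding der_def G_def by auto
  qed
  then show ?thesis using r(1) by blast
qed

text \<open>The chain rule for \<open>inv_into M f\<close> after \<open>f\<close> in the chosen
  charts. It converts an upper bound for the derivative of the inverse into the lower bound of
  \<open>der_bounds\<close>.\<close>

lemma der_inverse:
  assumes f: "f \<in> Diff1 M A" and q: "q \<in> M"
  shows "der (inv_into M f) (f q) (der f q v) = v"
proof -
  let ?g = "inv_into M f"
  have C1: "C1_map M A f" "C1_map M A ?g" and bij: "bij_betw f M M" using f by (auto simp: Diff1_def)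
  have gf: "?g (f x) = x" if "x \<in> M" for x using bij that by (simp add: bij_betw_def)
  note p = pos_in_core_pair[OF C1(1) q]
  have c: "ch q \<in> C" "ch (f q) \<in> C" using ch(1) q p(1) by auto
  define G where "G = chart_map (ch q) ` {x \<in> chart_dom (ch q). f x \<in> chart_dom (ch (f q))}"
  have G: "open G" "pos q \<in> G"
    using loc_domain_open[OF C1(1)] core_pair(2)[OF C1(1) c] p(2) c C(2) unfolding G_def by blast+
  have "(loc ?g (f q) \<circ> loc f q has_derivative der ?g (f q) \<circ> der f q) (at (pos q))"
    using diff_chain_at[OF loc_has_derivative[OF C1(1) q]] loc_has_derivative[OF C1(2) p(1)] loc_pos[OF q, of f] by simp
  moreover have "((\<lambda>y. y) has_derivative der ?g (f q) \<circ> der f q) (at (pos q))"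
  proof (rule has_derivative_transform_within_open[OF calculation G])
    fix y assume "y \<in> G"
    then obtain x where x: "x \<in> chart_dom (ch q)" "f x \<in> chart_dom (ch (f q))" "y = chart_map (ch q) x"
      by (auto simp: G_def)
    have "x \<in> M" using x(1) is_chartD(2)[OF chM[OF q]] by auto
    then show "(loc ?g (f q) \<circ> loc f q) y = y"
      using x is_chartD(6)[OF chM[OF q]] is_chartD(6)[OF chM[OF p(1)]] gf q by (simp add: loc_def)
  qed
  ultimately have "der ?g (f q) \<circ> der f q = (\<lambda>y. y)"
    using has_derivative_unique has_derivative_ident by blast
  then show ?thesis by (metis comp_apply)
qed

lemma der_bounds:
  assumes f: "f \<in> Diff1 M A"
  obtains B where "B \<ge> 1" "\<And>q v. q \<in> M \<Longrightarrow> norm (der f q v) \<le> B * norm v"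
    "\<And>q v. q \<in> M \<Longrightarrow> norm v \<le> B * norm (der f q v)"
proof -
  have C1: "C1_map M A f" "C1_map M A (inv_into M f)" using f by (auto simp: Diff1_def)
  obtain B1 where B1: "\<And>q v. q \<in> M \<Longrightarrow> norm (der f q v) \<le> B1 * norm v"
    using der_bounded[OF C1(1)] by blast
  obtain B2 where B2: "\<And>q v. q \<in> M \<Longrightarrow> norm (der (inv_into M f) q v) \<le> B2 * norm v"
    using der_bounded[OF C1(2)] by blast
  define B where "B = max 1 (max B1 B2)"
  have B: "B1 \<le> B" "B2 \<le> B" "1 \<le> B" by (auto simp: B_def)
  have "norm (der f q v) \<le> B * norm v" if "q \<in> M" for q v
    using B1[OF that, of v] mult_right_mono[OF B(1) norm_ge_zero[of v]] by linarith
  moreover have "norm v \<le> B * norm (der f q v)" if "q \<in> M" for q v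
    using B2[OF pos_in_core_pair(1)[OF C1(1) that], of "der f q v"] der_inverse[OF f that, of v]
      mult_right_mono[OF B(2) norm_ge_zero[of "der f q v"]] by simp
  ultimately show thesis using that[of B] B(3) by blast
qed

lemma funpow_in_M: "C1_map M A f \<Longrightarrow> q \<in> M \<Longrightarrow> (f ^^ i) q \<in> M"
  using funpow_image_subset[of f M i] by (auto simp: C1_map_def)

text \<open>Induction on \<open>m\<close>: the old error is magnified at most by \<open>B\<close>,
  and the new step adds its own error at a displacement of at most \<open>L\<close> times the
  initial one.\<close>

lemma iterate_uniformly_differentiable:
  assumes f: "C1_map M A f" and e: "e > 0"
  shows "\<exists>r>0. \<forall>q\<in>M. \<forall>y. norm (y - pos q) \<le> r \<longrightarrow>
           y \<in> chart_map (ch q) ` chart_dom (ch q) \<and>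
           (f ^^ m) (chart_inv (ch q) y) \<in> chart_dom (ch ((f ^^ m) q)) \<and>
           norm (chart_map (ch ((f ^^ m) q)) ((f ^^ m) (chart_inv (ch q) y)) - pos ((f ^^ m) q)
                 - comp_seq (\<lambda>i. der f ((f ^^ i) q)) m (y - pos q)) \<le> e * norm (y - pos q)"
  using e
proof (induction m arbitrary: e)
  case 0
  obtain r where r: "r > 0" "\<And>q. q \<in> M \<Longrightarrow> cball (pos q) r \<subseteq> chart_map (ch q) ` chart_dom (ch q)"
    by (rule core_radius) blast
  show ?case
  proof (intro exI[of _ r] conjI ballI allI impI r(1))
    fix q y assume q: "q \<in> M" and y: "norm (y - pos q) \<le> r"
    show yi: "y \<in> chart_map (ch q) ` chart_dom (ch q)"
      using r(2)[OF q] y by (auto simp: dist_norm norm_minus_commute)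
    show "(f ^^ 0) (chart_inv (ch q) y) \<in> chart_dom (ch ((f ^^ 0) q))"
      using is_chartD(8)[OF chM[OF q] yi] by simp
    show "norm (chart_map (ch ((f ^^ 0) q)) ((f ^^ 0) (chart_inv (ch q) y)) - pos ((f ^^ 0) q)
                 - comp_seq (\<lambda>i. der f ((f ^^ i) q)) 0 (y - pos q)) \<le> e * norm (y - pos q)"
      using is_chartD(7)[OF chM[OF q] yi] 0 by simp
  qed
next
  case (Suc m)
  obtain B0 where B0: "\<And>q v. q \<in> M \<Longrightarrow> norm (der f q v) \<le> B0 * norm v" using der_bounded[OF f] by blast
  define B where "B = max 1 B0"
  have B1: "B \<ge> 1" by (simp add: B_def)
  have B: "norm (der f q v) \<le> B * norm v" if "q \<in> M" for q v
    using B0[OF that, of v] mult_right_mono[of B0 B "norm v"] by (auto simp: B_def intro: order_trans)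
  \<comment> \<open>Each of the two errors receives \<open>e / 2\<close>: \<open>B * e1\<close> is
    at most that, and \<open>e2 * L\<close> equals it. The cap 1 on \<open>e1\<close> is what bounds
    the displacement after \<open>m\<close> steps by \<open>L = B ^ m + 1\<close>.\<close>
  define e1 where "e1 = min 1 (e / (2 * B))"
  define L where "L = B ^ m + 1"
  have L: "L \<ge> 1" using B1 by (simp add: L_def)
  define e2 where "e2 = e / (2 * L)"
  have pos: "e1 > 0" "e2 > 0" using Suc.prems B1 L by (auto simp: e1_def e2_def)
  obtain r1 where r1: "r1 > 0" and IH: "\<And>q y. q \<in> M \<Longrightarrow> norm (y - pos q) \<le> r1 \<Longrightarrow>
           y \<in> chart_map (ch q) ` chart_dom (ch q) \<and>
           (f ^^ m) (chart_inv (ch q) y) \<in> chart_dom (ch ((f ^^ m) q)) \<and>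
           norm (chart_map (ch ((f ^^ m) q)) ((f ^^ m) (chart_inv (ch q) y)) - pos ((f ^^ m) q)
                 - comp_seq (\<lambda>i. der f ((f ^^ i) q)) m (y - pos q)) \<le> e1 * norm (y - pos q)"
    using Suc.IH[OF pos(1)] by blast
  obtain r2 where r2: "r2 > 0" and step: "\<And>q y. q \<in> M \<Longrightarrow> norm (y - pos q) \<le> r2 \<Longrightarrow>
           y \<in> chart_map (ch q) ` chart_dom (ch q) \<and> f (chart_inv (ch q) y) \<in> chart_dom (ch (f q)) \<and>
           norm (loc f q y - pos (f q) - der f q (y - pos q)) \<le> e2 * norm (y - pos q)"
    using loc_uniformly_differentiable[OF f pos(2)] by blast
  \<comment> \<open>The quotient \<open>r2 / L\<close> keeps the image after \<open>m\<close> steps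
    within the radius \<open>r2\<close> on which the one-step estimate holds.\<close>
  define r where "r = min r1 (r2 / L)"
  have r: "r > 0" "r \<le> r1" "L * r \<le> r2" using r1 r2 L by (auto simp: r_def min_def field_simps)
  show ?case
  proof (intro exI[of _ r] conjI ballI allI impI r(1))
    fix q y assume q: "q \<in> M" and y: "norm (y - pos q) \<le> r"
    define qm where "qm = (f ^^ m) q"
    define x where "x = (f ^^ m) (chart_inv (ch q) y)"
    define y' where "y' = chart_map (ch qm) x"
    define v where "v = comp_seq (\<lambda>i. der f ((f ^^ i) q)) m (y - pos q)"
    have qm: "qm \<in> M" using funpow_in_M[OF f q] by (simp add: qm_def)
    have I: "y \<in> chart_map (ch q) ` chart_dom (ch q)" "x \<in> chart_dom (ch qm)"
      "norm (y' - pos qm - v) \<le> e1 * norm (y - pos q)"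
      using IH[OF q] y r(2) by (auto simp: y'_def qm_def x_def v_def)
    show "y \<in> chart_map (ch q) ` chart_dom (ch q)" by (rule I)
    have v: "norm v \<le> B ^ m * norm (y - pos q)"
      unfolding v_def using B funpow_in_M[OF f q] B1 by (intro comp_seq_norm_le) auto
    have "norm (y' - pos qm) \<le> norm (y' - pos qm - v) + norm v"
      by (metis diff_add_cancel norm_triangle_ineq)
    also have "\<dots> \<le> 1 * norm (y - pos q) + B ^ m * norm (y - pos q)"
      using v I(3) mult_right_mono[of e1 1 "norm (y - pos q)"] by (simp add: e1_def)
    finally have y': "norm (y' - pos qm) \<le> L * norm (y - pos q)" by (simp add: L_def algebra_simps)
    also have "\<dots> \<le> L * r" using y L by (intro mult_left_mono) auto
    finally have "norm (y' - pos qm) \<le> r2" using r(3) by simp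
    note S = step[OF qm this]
    have x: "chart_inv (ch qm) y' = x" unfolding y'_def using is_chartD(6)[OF chM[OF qm] I(2)] .
    show "(f ^^ Suc m) (chart_inv (ch q) y) \<in> chart_dom (ch ((f ^^ Suc m) q))"
      using S x by (simp add: qm_def x_def)
    have lin: "linear (der f qm)" by (rule linear_der[OF f qm])
    have loc: "loc f qm y' = chart_map (ch (f qm)) (f x)" by (simp add: loc_def x)
    have "norm (loc f qm y' - pos (f qm) - der f qm v)
        \<le> norm (loc f qm y' - pos (f qm) - der f qm (y' - pos qm)) + norm (der f qm (y' - pos qm - v))"
      using norm_triangle_ineq[of "loc f qm y' - pos (f qm) - der f qm (y' - pos qm)" "der f qm (y' - pos qm - v)"]
      by (simp add: linear_diff[OF lin])
    also have "\<dots> \<le> e / 2 * norm (y - pos q) + e / 2 * norm (y - pos q)"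
    proof (rule add_mono)
      have "norm (loc f qm y' - pos (f qm) - der f qm (y' - pos qm)) \<le> e2 * norm (y' - pos qm)" using S by blast
      also have "\<dots> \<le> e2 * (L * norm (y - pos q))" using y' pos by (intro mult_left_mono) auto
      also have "\<dots> = e / 2 * norm (y - pos q)" using L by (simp add: e2_def)
      finally show "norm (loc f qm y' - pos (f qm) - der f qm (y' - pos qm)) \<le> e / 2 * norm (y - pos q)" .
      have "norm (der f qm (y' - pos qm - v)) \<le> B * norm (y' - pos qm - v)" by (rule B[OF qm])
      also have "\<dots> \<le> B * (e1 * norm (y - pos q))" using I(3) B1 by (intro mult_left_mono) auto
      also have "\<dots> \<le> B * (e / (2 * B) * norm (y - pos q))"
        using B1 by (intro mult_left_mono mult_right_mono) (auto simp: e1_def)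
      also have "\<dots> = e / 2 * norm (y - pos q)" using B1 by simp
      finally show "norm (der f qm (y' - pos qm - v)) \<le> e / 2 * norm (y - pos q)" .
    qed
    finally show "norm (chart_map (ch ((f ^^ Suc m) q)) ((f ^^ Suc m) (chart_inv (ch q) y)) - pos ((f ^^ Suc m) q)
                 - comp_seq (\<lambda>i. der f ((f ^^ i) q)) (Suc m) (y - pos q)) \<le> e * norm (y - pos q)"
      unfolding loc by (simp add: qm_def x_def v_def)
  qed
qed

section \<open>Contraction of coordinate balls along orbits\<close>

definition stretch :: "('a \<Rightarrow> 'a) \<Rightarrow> nat \<Rightarrow> 'a \<Rightarrow> real" where
  "stretch f m q = 2 * onorm (comp_seq (\<lambda>i. der f ((f ^^ i) q)) m)"

lemma stretch_nonneg: "C1_map M A f \<Longrightarrow> q \<in> M \<Longrightarrow> 0 \<le> stretch f m q"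
  unfolding stretch_def
  by (intro mult_nonneg_nonneg onorm_pos_le linear_conv_bounded_linear[THEN iffD1] linear_comp_seq linear_der)
    (auto simp: funpow_in_M)

text \<open>Since \<open>f\<close> is a diffeomorphism, the norm of the derivative of \<open>f ^^ m\<close> is bounded away from 0 and
  the error of the linear approximation can be absorbed by the factor 2.\<close>

lemma iterate_stretch:
  assumes f: "f \<in> Diff1 M A"
  shows "\<exists>r>0. \<forall>q\<in>M. \<forall>y. norm (y - pos q) \<le> r \<longrightarrow>
           y \<in> chart_map (ch q) ` chart_dom (ch q) \<and>
           (f ^^ m) (chart_inv (ch q) y) \<in> chart_dom (ch ((f ^^ m) q)) \<and>
           norm (chart_map (ch ((f ^^ m) q)) ((f ^^ m) (chart_inv (ch q) y)) - pos ((f ^^ m) q))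
             \<le> stretch f m q * norm (y - pos q)"
proof -
  have C1: "C1_map M A f" using f by (simp add: Diff1_def)
  obtain B where B: "B \<ge> 1" "\<And>q v. q \<in> M \<Longrightarrow> norm v \<le> B * norm (der f q v)"
    using der_bounds[OF f] by metis
  have "1 / B ^ m > 0" using B by simp
  from iterate_uniformly_differentiable[OF C1 this, of m]
  obtain r where r: "r > 0" and app: "\<And>q y. q \<in> M \<Longrightarrow> norm (y - pos q) \<le> r \<Longrightarrow>
           y \<in> chart_map (ch q) ` chart_dom (ch q) \<and>
           (f ^^ m) (chart_inv (ch q) y) \<in> chart_dom (ch ((f ^^ m) q)) \<and>
           norm (chart_map (ch ((f ^^ m) q)) ((f ^^ m) (chart_inv (ch q) y)) - pos ((f ^^ m) q)
                 - comp_seq (\<lambda>i. der f ((f ^^ i) q)) m (y - pos q)) \<le> 1 / B ^ m * norm (y - pos q)" by blast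
  show ?thesis
  proof (intro exI[of _ r] conjI ballI allI impI r)
    fix q y assume q: "q \<in> M" and y: "norm (y - pos q) \<le> r"
    note a = app[OF q y]
    show "y \<in> chart_map (ch q) ` chart_dom (ch q)" "(f ^^ m) (chart_inv (ch q) y) \<in> chart_dom (ch ((f ^^ m) q))"
      using a by blast+
    define T where "T = comp_seq (\<lambda>i. der f ((f ^^ i) q)) m"
    have T: "bounded_linear T" unfolding T_def
      by (intro linear_conv_bounded_linear[THEN iffD1] linear_comp_seq linear_der C1 funpow_in_M q)
    define z where "z = chart_map (ch ((f ^^ m) q)) ((f ^^ m) (chart_inv (ch q) y)) - pos ((f ^^ m) q)"
    have "norm (y - pos q) \<le> B ^ m * norm (T (y - pos q))"
      unfolding T_def using B funpow_in_M[OF C1 q] by (intro comp_seq_norm_ge) auto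
    then have "1 / B ^ m * norm (y - pos q) \<le> norm (T (y - pos q))" using B(1) by (simp add: field_simps)
    moreover have "norm (T (y - pos q)) \<le> onorm T * norm (y - pos q)" by (rule onorm[OF T])
    moreover have "norm (z - T (y - pos q)) \<le> 1 / B ^ m * norm (y - pos q)" using a by (simp add: z_def T_def)
    moreover have "norm z \<le> norm (z - T (y - pos q)) + norm (T (y - pos q))"
      by (metis diff_add_cancel norm_triangle_ineq)
    ultimately have "norm z \<le> onorm T * norm (y - pos q) + onorm T * norm (y - pos q)" by linarith
    then show "norm (chart_map (ch ((f ^^ m) q)) ((f ^^ m) (chart_inv (ch q) y)) - pos ((f ^^ m) q))
             \<le> stretch f m q * norm (y - pos q)"
      unfolding stretch_def T_def[symmetric] z_def[symmetric] by linarith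
  qed
qed

text \<open>Each step may be applied only within radius \<open>r\<close> of the orbit. The
  assumption on all partial products, not just the last, keeps them at most 1 and so keeps the point
  inside that radius, which does not depend on \<open>N\<close>.\<close>

lemma orbit_contraction:
  fixes F :: "'a \<Rightarrow> 'a"
  assumes F: "F ` M \<subseteq> M" and a: "\<And>q. q \<in> M \<Longrightarrow> 0 \<le> a q"
    and step: "\<And>q y. q \<in> M \<Longrightarrow> norm (y - pos q) \<le> r \<Longrightarrow>
           y \<in> chart_map (ch q) ` chart_dom (ch q) \<and> F (chart_inv (ch q) y) \<in> chart_dom (ch (F q)) \<and>
           norm (chart_map (ch (F q)) (F (chart_inv (ch q) y)) - pos (F q)) \<le> a q * norm (y - pos q)"
    and q: "q \<in> M" and y: "norm (y - pos q) \<le> r"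
    and prod: "\<And>l. l \<le> N \<Longrightarrow> (\<Prod>i<l. a ((F ^^ i) q)) \<le> (1/2) ^ l"
    and l: "l \<le> N"
  shows "(F ^^ l) (chart_inv (ch q) y) \<in> chart_dom (ch ((F ^^ l) q)) \<and>
    norm (chart_map (ch ((F ^^ l) q)) ((F ^^ l) (chart_inv (ch q) y)) - pos ((F ^^ l) q)) \<le> (1/2) ^ l * r"
proof -
  have FM: "(F ^^ i) q \<in> M" for i using funpow_image_subset[OF F] q by blast
  have "(F ^^ l) (chart_inv (ch q) y) \<in> chart_dom (ch ((F ^^ l) q)) \<and>
    norm (chart_map (ch ((F ^^ l) q)) ((F ^^ l) (chart_inv (ch q) y)) - pos ((F ^^ l) q))
      \<le> (\<Prod>i<l. a ((F ^^ i) q)) * norm (y - pos q)"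
    using l
  proof (induction l)
    case 0
    have "y \<in> chart_map (ch q) ` chart_dom (ch q)" using step[OF q y] by blast
    then show ?case using is_chartD(7,8)[OF chM[OF q]] by auto
  next
    case (Suc l)
    define x where "x = (F ^^ l) (chart_inv (ch q) y)"
    define ql where "ql = (F ^^ l) q"
    define y' where "y' = chart_map (ch ql) x"
    have IH: "x \<in> chart_dom (ch ql)" "norm (y' - pos ql) \<le> (\<Prod>i<l. a ((F ^^ i) q)) * norm (y - pos q)"
      using Suc by (auto simp: x_def ql_def y'_def)
    have qlM: "ql \<in> M" using FM by (simp add: ql_def)
    have "(1/2 :: real) ^ l \<le> 1" by (intro power_le_one) auto
    then have "(\<Prod>i<l. a ((F ^^ i) q)) \<le> 1" using prod[of l] Suc.prems by linarith
    then have "(\<Prod>i<l. a ((F ^^ i) q)) * norm (y - pos q) \<le> 1 * r"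
      using y by (intro mult_mono) auto
    then have "norm (y' - pos ql) \<le> r" using IH(2) by simp
    note S = step[OF qlM this]
    have x: "chart_inv (ch ql) y' = x" unfolding y'_def using is_chartD(6)[OF chM[OF qlM] IH(1)] .
    have "norm (chart_map (ch (F ql)) (F x) - pos (F ql)) \<le> a ql * norm (y' - pos ql)" using S x by simp
    also have "\<dots> \<le> a ql * ((\<Prod>i<l. a ((F ^^ i) q)) * norm (y - pos q))"
      using IH(2) a[OF qlM] by (intro mult_left_mono)
    finally show ?case using S x by (simp add: x_def ql_def mult_ac)
  qed
  moreover have "(\<Prod>i<l. a ((F ^^ i) q)) * norm (y - pos q) \<le> (1/2) ^ l * r"
    using y prod[OF l] by (intro mult_mono) auto
  ultimately show ?thesis by linarith
qed

text \<open>A Lebesgue number for the cover, obtained in each compact core and made uniform over the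
  finitely many charts.\<close>

lemma cover_scale:
  assumes U: "openin (top_of_set M) U" and V: "openin (top_of_set M) V" and UV: "U \<union> V = M"
  shows "\<exists>s>0. \<forall>q\<in>M. {x \<in> chart_dom (ch q). norm (chart_map (ch q) x - pos q) < s} \<subseteq> U \<or>
                       {x \<in> chart_dom (ch q). norm (chart_map (ch q) x - pos q) < s} \<subseteq> V"
proof -
  define P where "P c s \<longleftrightarrow> (\<forall>z\<in>core c. {x \<in> chart_dom c. norm (chart_map c x - z) < s} \<subseteq> U \<or>
                       {x \<in> chart_dom c. norm (chart_map c x - z) < s} \<subseteq> V)" for c s
  have "\<exists>s>0. \<forall>c\<in>C. P c s"
  proof (rule finite_uniform_pos[OF C(1)])
    fix c assume c: "c \<in> C"
    note D = is_chartD[OF chC[OF c]]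
    let ?G = "{chart_map c ` (U \<inter> chart_dom c), chart_map c ` (V \<inter> chart_dom c)}"
    have "core c \<subseteq> \<Union> ?G"
    proof
      fix z assume "z \<in> core c"
      then obtain x where "z = chart_map c x" "x \<in> chart_dom c" using core(2)[OF c] by auto
      moreover from this have "x \<in> U \<or> x \<in> V" using D(2) UV by blast
      ultimately show "z \<in> \<Union> ?G" by auto
    qed
    moreover have "open G" if "G \<in> ?G" for G using that chart_image_open[OF chC[OF c]] U V by auto
    ultimately obtain s where s: "s > 0" "\<And>z. z \<in> core c \<Longrightarrow> \<exists>G\<in>?G. ball z s \<subseteq> G"
      using Heine_Borel_lemma[OF core(1)[OF c], of ?G] by blast
    have *: "{x \<in> chart_dom c. norm (chart_map c x - z) < s} \<subseteq> X"
      if "ball z s \<subseteq> chart_map c ` (X \<inter> chart_dom c)" for z X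
    proof safe
      fix x assume x: "x \<in> chart_dom c" "norm (chart_map c x - z) < s"
      then have "chart_map c x \<in> chart_map c ` (X \<inter> chart_dom c)"
        using that by (auto simp: dist_norm norm_minus_commute)
      then obtain x' where x': "chart_map c x = chart_map c x'" "x' \<in> X" "x' \<in> chart_dom c" by auto
      have "chart_inv c (chart_map c x) = x'" unfolding x'(1) by (rule D(6)[OF x'(3)])
      then show "x \<in> X" using x'(2) unfolding D(6)[OF x(1)] by simp
    qed
    have "P c s" unfolding P_def
    proof
      fix z assume "z \<in> core c"
      from s(2)[OF this] show "{x \<in> chart_dom c. norm (chart_map c x - z) < s} \<subseteq> U \<or>
                       {x \<in> chart_dom c. norm (chart_map c x - z) < s} \<subseteq> V"
        using *[of z U] *[of z V] by auto
    qed
    then show "\<exists>s>0. P c s" using s(1) by blast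
  next
    fix c and s s' :: real assume *: "P c s" "s' \<le> s"
    have sub: "{x \<in> chart_dom c. norm (chart_map c x - z) < s'} \<subseteq> {x \<in> chart_dom c. norm (chart_map c x - z) < s}" for z
      using *(2) by auto
    show "P c s'" unfolding P_def
    proof
      fix z assume "z \<in> core c"
      then show "{x \<in> chart_dom c. norm (chart_map c x - z) < s'} \<subseteq> U \<or> {x \<in> chart_dom c. norm (chart_map c x - z) < s'} \<subseteq> V"
        using *(1) subset_trans[OF sub[of z]] unfolding P_def by meson
    qed
  qed
  then obtain s where s: "s > 0" "\<And>c. c \<in> C \<Longrightarrow> P c s" by blast
  have "{x \<in> chart_dom (ch q). norm (chart_map (ch q) x - pos q) < s} \<subseteq> U \<or>
                       {x \<in> chart_dom (ch q). norm (chart_map (ch q) x - pos q) < s} \<subseteq> V" if "q \<in> M" for q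
    using s(2)[OF ch(1)[OF that]] ch(3)[OF that] unfolding P_def pos_def by blast
  then show ?thesis using s(1) by blast
qed

section \<open>Finiteness from a robust bound in charts\<close>

text \<open>Infinitely many \<open>q k\<close> use the same chart, and a subsequence of their
  coordinates converges in its core. \<open>W\<close> is a coordinate ball around the limit that
  lies within the contraction radius of all late members. Any given number of contracting steps is
  available from some late member, so all of \<open>W\<close> contracts.\<close>

lemma contracting_limit:
  fixes q :: "nat \<Rightarrow> 'a"
  assumes f: "f \<in> Diff1 M A" and m: "m > 0" and q: "\<And>k. q k \<in> M"
    and N: "\<And>l. \<exists>k0. \<forall>k\<ge>k0. l \<le> N k"
    and prod: "\<And>k l. l \<le> N k \<Longrightarrow> (\<Prod>i<l. stretch f m (((f ^^ m) ^^ i) (q k))) \<le> (1/2) ^ l"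
  obtains W where "openin (top_of_set M) W" "infinite {k. q k \<in> W}"
    "\<And>U V. openin (top_of_set M) U \<Longrightarrow> openin (top_of_set M) V \<Longrightarrow> U \<union> V = M \<Longrightarrow>
       \<exists>T. \<forall>t\<ge>T. (f ^^ t) ` W \<subseteq> U \<or> (f ^^ t) ` W \<subseteq> V"
proof -
  have C1: "C1_map M A f" using f by (simp add: Diff1_def)
  have cont: "continuous_on M f" and fM: "f ` M \<subseteq> M" using C1 by (auto simp: C1_map_def)
  define F where "F = f ^^ m"
  have FM: "F ` M \<subseteq> M" unfolding F_def by (rule funpow_image_subset[OF fM])
  obtain r where r: "r > 0" and step: "\<And>q y. q \<in> M \<Longrightarrow> norm (y - pos q) \<le> r \<Longrightarrow>
           y \<in> chart_map (ch q) ` chart_dom (ch q) \<and> F (chart_inv (ch q) y) \<in> chart_dom (ch (F q)) \<and>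
           norm (chart_map (ch (F q)) (F (chart_inv (ch q) y)) - pos (F q)) \<le> stretch f m q * norm (y - pos q)"
    using iterate_stretch[OF f, of m] unfolding F_def by blast
  have "\<exists>c\<in>C. infinite {k \<in> UNIV. ch (q k) = c}"
    by (rule pigeonhole_infinite_rel[of UNIV C]) (use C ch(1) q in auto)
  then obtain c where c: "c \<in> C" "infinite {k. ch (q k) = c}" by auto
  define s where "s = enumerate {k. ch (q k) = c}"
  have s: "strict_mono s" "\<And>k. ch (q (s k)) = c"
    using strict_mono_enumerate[OF c(2)] enumerate_in_set[OF c(2)] by (auto simp: s_def)
  have "\<forall>k. pos (q (s k)) \<in> core c" using ch(3)[OF q] s(2) unfolding pos_def by metis
  then obtain y t where y: "y \<in> core c" "strict_mono t" "((\<lambda>k. pos (q (s k))) \<circ> t) \<longlonglongrightarrow> y"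
    using core(1)[OF c(1)] unfolding compact_def by meson
  define u where "u = s \<circ> t"
  have u: "strict_mono u" "\<And>k. ch (q (u k)) = c" "(\<lambda>k. pos (q (u k))) \<longlonglongrightarrow> y"
    using s y strict_mono_o by (auto simp: u_def o_def)
  obtain k1 where k1: "\<And>k. k \<ge> k1 \<Longrightarrow> norm (pos (q (u k)) - y) < r / 2"
    using LIMSEQ_D[OF u(3), of "r/2"] r by auto
  \<comment> \<open>Half the radius covers the distance from \<open>z\<close> to the limit
    \<open>y\<close>, the other half that from \<open>y\<close> to the member of the
    sequence.\<close>
  have near: "norm (z - pos (q (u k))) \<le> r" if "z \<in> ball y (r / 2)" "k \<ge> k1" for z k
  proof -
    have "norm (z - pos (q (u k))) \<le> norm (z - y) + norm (y - pos (q (u k)))"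
      using norm_triangle_ineq[of "z - y" "y - pos (q (u k))"] by simp
    then show ?thesis using k1[OF that(2)] that(1) by (simp add: dist_norm norm_minus_commute)
  qed
  define W where "W = chart_inv c ` ball y (r / 2)"
  have "ball y (r / 2) \<subseteq> chart_map c ` chart_dom c"
  proof
    fix z assume "z \<in> ball y (r / 2)"
    from step[OF q near[OF this order_refl]] show "z \<in> chart_map c ` chart_dom c" using u(2) by simp
  qed
  then have "openin (top_of_set M) W" unfolding W_def by (intro chart_inv_image_openin chC c(1)) auto
  moreover have "infinite {k. q k \<in> W}"
  proof
    assume fin: "finite {k. q k \<in> W}"
    have "q (u k) \<in> W" if "k \<ge> k1" for k
      unfolding W_def using k1[OF that] chart_inv_pos[OF q] u(2)
      by (intro image_eqI[of _ _ "pos (q (u k))"]) (auto simp: dist_norm norm_minus_commute, metis)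
    then have "u ` {k1..} \<subseteq> {k. q k \<in> W}" by auto
    then have "finite (u ` {k1..})" using fin finite_subset by blast
    then have "finite {k1..}" using finite_imageD strict_mono_imp_inj_on[OF u(1)] inj_on_subset by blast
    then show False using infinite_Ici by blast
  qed
  moreover have "\<exists>T. \<forall>t\<ge>T. (f ^^ t) ` W \<subseteq> U \<or> (f ^^ t) ` W \<subseteq> V"
    if U: "openin (top_of_set M) U" and V: "openin (top_of_set M) V" and UV: "U \<union> V = M" for U V
  proof -
    \<comment> \<open>\<open>F\<close> only controls times divisible by \<open>m\<close>. Pulling
      the cover back by \<open>f ^^ i\<close> for \<open>i < m\<close> takes care of the
      remainders.\<close>
    define P where "P i s \<longleftrightarrow> (\<forall>q\<in>M. {x \<in> chart_dom (ch q). norm (chart_map (ch q) x - pos q) < s} \<subseteq> M \<inter> (f ^^ i) -` U \<or>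
                       {x \<in> chart_dom (ch q). norm (chart_map (ch q) x - pos q) < s} \<subseteq> M \<inter> (f ^^ i) -` V)" for i s
    have "\<exists>s>0. \<forall>i\<in>{..<m}. P i s"
    proof (rule finite_uniform_pos)
      fix i
      have "openin (top_of_set M) (M \<inter> (f ^^ i) -` X)" if "openin (top_of_set M) X" for X
        using continuous_openin_preimage[OF continuous_on_funpow[OF cont fM] _ that] funpow_image_subset[OF fM] by auto
      moreover have "(M \<inter> (f ^^ i) -` U) \<union> (M \<inter> (f ^^ i) -` V) = M"
        using funpow_image_subset[OF fM, of i] UV by blast
      ultimately show "\<exists>s>0. P i s" unfolding P_def using U V by (intro cover_scale) auto
    next
      fix i and s s' :: real assume *: "P i s" "s' \<le> s"
      have sub: "{x \<in> chart_dom (ch q). norm (chart_map (ch q) x - pos q) < s'}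
          \<subseteq> {x \<in> chart_dom (ch q). norm (chart_map (ch q) x - pos q) < s}" for q
        using *(2) by auto
      show "P i s'" unfolding P_def
      proof
        fix q assume "q \<in> M"
        then show "{x \<in> chart_dom (ch q). norm (chart_map (ch q) x - pos q) < s'} \<subseteq> M \<inter> (f ^^ i) -` U \<or>
            {x \<in> chart_dom (ch q). norm (chart_map (ch q) x - pos q) < s'} \<subseteq> M \<inter> (f ^^ i) -` V"
          using *(1) subset_trans[OF sub[of q]] unfolding P_def by meson
      qed
    qed auto
    then obtain s where s: "s > 0" "\<And>i. i < m \<Longrightarrow> P i s" by auto
    obtain l0 where l0: "(1/2) ^ l0 < s / r" using real_arch_pow_inv[of "s / r" "1/2"] s r by auto
    have "(f ^^ t) ` W \<subseteq> U \<or> (f ^^ t) ` W \<subseteq> V" if t: "t \<ge> m * l0" for t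
    proof -
      define l where "l = t div m"
      define i where "i = t mod m"
      have l: "l0 \<le> l" using div_le_mono[OF t, of m] m by (simp add: l_def)
      have i: "i < m" using m by (simp add: i_def)
      have ft: "(f ^^ t) x = (f ^^ i) ((F ^^ l) x)" for x
      proof -
        have "t = i + m * l" by (simp add: l_def i_def)
        then show ?thesis by (simp only: funpow_add comp_apply F_def funpow_mult)
      qed
      obtain k0 where k0: "\<And>k. k \<ge> k0 \<Longrightarrow> l \<le> N k" using N by blast
      \<comment> \<open>The member of the sequence is chosen after \<open>t\<close>, and so is the
        centre \<open>p\<close>. This is harmless because the scale \<open>s\<close> serves every
        centre in \<open>M\<close>.\<close>
      define k where "k = max k1 k0"
      have "k0 \<le> u k" using strict_mono_imp_increasing[OF u(1), of k] by (simp add: k_def)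
      then have Nk: "l \<le> N (u k)" by (rule k0)
      have kk1: "k \<ge> k1" by (simp add: k_def)
      define p where "p = (F ^^ l) (q (u k))"
      have pM: "p \<in> M" unfolding p_def using funpow_image_subset[OF FM] q by blast
      have small: "(1/2) ^ l * r < s"
      proof -
        have "(1/2 :: real) ^ l \<le> (1/2) ^ l0" using l by (intro power_decreasing) auto
        then have "(1/2) ^ l < s / r" using l0 by linarith
        then show ?thesis using r by (simp add: field_simps)
      qed
      have "(F ^^ l) x \<in> {x \<in> chart_dom (ch p). norm (chart_map (ch p) x - pos p) < s}" if "x \<in> W" for x
      proof -
        obtain z where z: "z \<in> ball y (r / 2)" "x = chart_inv c z" using \<open>x \<in> W\<close> by (auto simp: W_def)
        have "(F ^^ l) (chart_inv (ch (q (u k))) z) \<in> chart_dom (ch ((F ^^ l) (q (u k)))) \<and>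
          norm (chart_map (ch ((F ^^ l) (q (u k)))) ((F ^^ l) (chart_inv (ch (q (u k))) z)) - pos ((F ^^ l) (q (u k))))
            \<le> (1/2) ^ l * r"
        proof (rule orbit_contraction[OF FM stretch_nonneg[OF C1] step q near[OF z(1) kk1] _ Nk])
          show "(\<Prod>i<l. stretch f m ((F ^^ i) (q (u k)))) \<le> (1/2) ^ l" if "l \<le> N (u k)" for l
            using prod[OF that] by (simp add: F_def)
        qed
        then show ?thesis using small z(2) u(2) by (simp add: p_def)
      qed
      then have "(F ^^ l) ` W \<subseteq> M \<inter> (f ^^ i) -` U \<or> (F ^^ l) ` W \<subseteq> M \<inter> (f ^^ i) -` V"
        using s(2)[OF i] pM unfolding P_def by blast
      then show ?thesis
      proof
        assume "(F ^^ l) ` W \<subseteq> M \<inter> (f ^^ i) -` U"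
        then have "(f ^^ t) ` W \<subseteq> U" by (auto simp: ft)
        then show ?thesis ..
      next
        assume "(F ^^ l) ` W \<subseteq> M \<inter> (f ^^ i) -` V"
        then have "(f ^^ t) ` W \<subseteq> V" by (auto simp: ft)
        then show ?thesis ..
      qed
    qed
    then show ?thesis by blast
  qed
  ultimately show thesis by (rule that)
qed

lemma finite_of_robust_bound:
  assumes f: "f \<in> Diff1 M A" and S: "S \<subseteq> nonwandering_set M f"
    and n: "n ` S \<subseteq> {1..}" "finite_preimages S {1..} n" and e: "e > 0"
    and robust: "\<And>p L u. p \<in> S \<Longrightarrow>
      (\<And>i. i < n p \<Longrightarrow> linear (L i) \<and> bij (L i) \<and> (\<forall>z. norm (L i z - der f ((f ^^ i) p) z) \<le> e * norm z))
      \<Longrightarrow> norm (comp_seq L (n p) u) \<le> K * norm u"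
  shows "finite S"
proof (rule ccontr)
  assume "infinite S"
  then obtain p :: "nat \<Rightarrow> 'a" where p: "inj p" "range p \<subseteq> S" using infinite_countable_subset by blast
  have C1: "C1_map M A f" and bij: "bij_betw f M M" using f by (auto simp: Diff1_def)
  have cont: "continuous_on M f" and fM: "f ` M \<subseteq> M" using C1 by (auto simp: C1_map_def)
  have pS: "p k \<in> S" for k using p by blast
  then have pM: "p k \<in> M" for k using S by (auto simp: nonwandering_set_def)
  \<comment> \<open>An injective sequence in \<open>S\<close> takes each value of \<open>n\<close>
    finitely often, so \<open>n\<close> tends to infinity along it.\<close>
  have n_large: "\<exists>k0. \<forall>k\<ge>k0. l \<le> n (p k)" for l
  proof -
    have "finite {k. n (p k) = j}" for j
    proof (cases "j \<ge> 1")
      case True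
      then have "finite {x \<in> S. n x = j}" using n(2) by (simp add: finite_preimages_def)
      then have "finite (p -` {x \<in> S. n x = j})" using p(1) finite_vimageI by blast
      then show ?thesis using pS by (simp add: vimage_def)
    next
      case False
      have "1 \<le> n (p k)" for k using n(1) pS by force
      then have "{k. n (p k) = j} = {}" using False by auto
      then show ?thesis by simp
    qed
    then have "finite (\<Union>j<l. {k. n (p k) = j})" by blast
    moreover have "(\<Union>j<l. {k. n (p k) = j}) = {k. n (p k) < l}" by auto
    ultimately have "finite {k. n (p k) < l}" by simp
    then obtain k0 where "\<forall>k\<in>{k. n (p k) < l}. k < k0" using finite_nat_set_iff_bounded by blast
    then show ?thesis by (intro exI[of _ k0]) (auto simp: not_less[symmetric])
  qed
  obtain B where B: "B \<ge> 1" "\<And>q v. q \<in> M \<Longrightarrow> norm (der f q v) \<le> B * norm v"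
    "\<And>q v. q \<in> M \<Longrightarrow> norm v \<le> B * norm (der f q v)"
    using der_bounds[OF f] by metis
  \<comment> \<open>\<open>d\<close> depends only on \<open>e\<close> and \<open>B\<close>, and
    \<open>m\<close> only on \<open>d\<close>; neither depends on the point or on its time
    \<open>n\<close>.\<close>
  define d where "d = min (1/2) (e / (3 * B))"
  have d: "0 < d" "d \<le> 1/2" "3 * B * d \<le> e" using e B(1) by (auto simp: d_def min_def field_simps)
  obtain m where m: "8 / d < (1 + d) ^ m" using real_arch_pow[of "1 + d" "8 / d"] d by auto
  have m8: "8 \<le> d * (1 + d) ^ m" using m d by (simp add: field_simps)
  have m0: "m > 0" using m8 d by (cases m) auto
  have "\<exists>j. j \<le> n (p k) div m \<and>
    (\<forall>l. j + l \<le> n (p k) div m \<longrightarrow> (\<Prod>i<l. 2 * onorm (comp_seq (\<lambda>i'. der f ((f ^^ ((j + i) * m + i')) (p k))) m)) \<le> (1/2) ^ l) \<and>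
    2 ^ (n (p k) div m) * (1 / B ^ m) ^ (n (p k) div m - j) \<le> B ^ m * K" for k
    by (rule robust_bound_contraction[of "\<lambda>i. der f ((f ^^ i) (p k))" B d e m "n (p k)" K,
          OF linear_der[OF C1 funpow_in_M[OF C1 pM]] B(2)[OF funpow_in_M[OF C1 pM]]
            B(3)[OF funpow_in_M[OF C1 pM]] B(1) d m0 m8 robust[OF pS]]) blast+
  then obtain j where j: "\<And>k. j k \<le> n (p k) div m"
    and pr: "\<And>k l. j k + l \<le> n (p k) div m \<Longrightarrow>
       (\<Prod>i<l. 2 * onorm (comp_seq (\<lambda>i'. der f ((f ^^ ((j k + i) * m + i')) (p k))) m)) \<le> (1/2) ^ l"
    and long: "\<And>k. 2 ^ (n (p k) div m) * (1 / B ^ m) ^ (n (p k) div m - j k) \<le> B ^ m * K"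
    by metis
  \<comment> \<open>\<open>q k\<close> is the orbit point after the \<open>j k\<close> blocks
    skipped by the Pliss argument, and \<open>N k\<close> counts the contracting blocks that
    remain.\<close>
  define q where "q k = (f ^^ (j k * m)) (p k)" for k
  define N where "N k = n (p k) div m - j k" for k
  have qM: "q k \<in> M" for k unfolding q_def by (rule funpow_in_M[OF C1 pM])
  have qW: "q k \<in> nonwandering_set M f" for k
    unfolding q_def using S pS by (intro nonwandering_set_invariant[OF cont fM]) auto
  \<comment> \<open>If fewer than \<open>l\<close> blocks remained, then
    \<open>2 ^ (n (p k) div m) * c ^ l\<close> would be at most \<open>B ^ m * K\<close>, which
    fails once \<open>n (p k)\<close> is large.\<close>
  have N_large: "\<exists>k0. \<forall>k\<ge>k0. l \<le> N k" for l
  proof -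
    define c where "c = 1 / B ^ m"
    have c: "0 < c" "c \<le> 1" using B(1) by (auto simp: c_def)
    obtain h where h: "B ^ m * K / c ^ l < 2 ^ h" using real_arch_pow[of 2 "B ^ m * K / c ^ l"] by auto
    obtain k0 where k0: "\<And>k. k \<ge> k0 \<Longrightarrow> h * m \<le> n (p k)" using n_large by blast
    have "l \<le> N k" if "k \<ge> k0" for k
    proof (rule ccontr)
      assume "\<not> l \<le> N k"
      then have "c ^ l \<le> c ^ N k" using c by (intro power_decreasing) auto
      moreover have "h \<le> n (p k) div m" using div_le_mono[OF k0[OF that], of m] m0 by simp
      then have "(2::real) ^ h \<le> 2 ^ (n (p k) div m)" by (intro power_increasing) auto
      ultimately have "2 ^ h * c ^ l \<le> 2 ^ (n (p k) div m) * c ^ N k" using c by (intro mult_mono) auto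
      also have "\<dots> \<le> B ^ m * K" using long[of k] by (simp add: c_def N_def)
      finally show False using h c by (simp add: field_simps)
    qed
    then show ?thesis by blast
  qed
  have contr: "(\<Prod>i<l. stretch f m (((f ^^ m) ^^ i) (q k))) \<le> (1/2) ^ l" if "l \<le> N k" for k l
  proof -
    have "(f ^^ i') (((f ^^ m) ^^ i) (q k)) = (f ^^ ((j k + i) * m + i')) (p k)" for i i'
    proof -
      have "(j k + i) * m + i' = i' + (m * i + j k * m)" by (simp add: algebra_simps)
      then show ?thesis unfolding q_def by (simp only: funpow_mult funpow_add comp_apply)
    qed
    then show ?thesis using pr[of k l] that j[of k] by (simp add: stretch_def N_def)
  qed
  obtain W where W: "openin (top_of_set M) W" "infinite {k. q k \<in> W}"
    and shrink: "\<And>U V. openin (top_of_set M) U \<Longrightarrow> openin (top_of_set M) V \<Longrightarrow> U \<union> V = M \<Longrightarrow>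
       \<exists>T. \<forall>t\<ge>T. (f ^^ t) ` W \<subseteq> U \<or> (f ^^ t) ` W \<subseteq> V"
    by (rule contracting_limit[OF f m0 qM N_large contr]) blast+
  obtain k1 where k1: "q k1 \<in> W" using W(2) not_finite_existsD by auto
  obtain t where t: "t \<ge> 1" "(f ^^ t) (q k1) = q k1"
    using shrinking_nonwandering_periodic[OF compact_M cont fM W(1) shrink k1 qW] .
  have "q k = q k1" if "q k \<in> W" for k
    by (rule shrinking_nonwandering_unique[OF compact_M cont fM W(1) shrink that qW k1 qW])
  then have "p ` {k. q k \<in> W} \<subseteq> {x \<in> M. \<exists>i. (f ^^ i) x = q k1}"
    using pM by (auto simp: q_def)
  moreover have "finite {x \<in> M. \<exists>i. (f ^^ i) x = q k1}"
    using preperiodic_finite[OF bij_betw_imp_inj_on[OF bij] fM qM t] .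
  ultimately have "finite (p ` {k. q k \<in> W})" using finite_subset by blast
  then show False using W(2) finite_imageD p(1) inj_on_subset by blast
qed

section \<open>Tangent spaces in charts\<close>

definition transition :: "('a, 'e) chart \<Rightarrow> ('a, 'e) chart \<Rightarrow> 'a \<Rightarrow> 'e \<Rightarrow> 'e" where
  "transition c c' p = frechet_derivative (chart_map c' \<circ> chart_inv c) (at (chart_map c p))"

lemma ch_charts_at: "p \<in> M \<Longrightarrow> ch p \<in> charts_at A p"
  using ch C by (auto simp: charts_at_def)

lemma charts_atD: "c \<in> charts_at A p \<Longrightarrow> is_chart M c" "c \<in> charts_at A p \<Longrightarrow> p \<in> chart_dom c"
  "c \<in> charts_at A p \<Longrightarrow> p \<in> M"
  using chart is_chartD(2) by (fastforce simp: charts_at_def)+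

lemma transition_has_derivative:
  assumes "c \<in> charts_at A p" "c' \<in> charts_at A p"
  shows "(chart_map c' \<circ> chart_inv c has_derivative transition c c' p) (at (chart_map c p))"
  unfolding transition_def
proof (rule smooth_on_differentiable)
  show "smooth_on (chart_map c' \<circ> chart_inv c) (chart_map c ` (chart_dom c \<inter> chart_dom c'))"
    using closed assms by (auto simp: closed_manifold_def smooth_atlas_def charts_at_def)
qed (use assms in \<open>auto simp: charts_at_def\<close>)

lemma overlap_open:
  assumes "c \<in> charts_at A p" "c' \<in> charts_at A p"
  shows "open (chart_map c ` (chart_dom c' \<inter> chart_dom c))"
    "chart_map c p \<in> chart_map c ` (chart_dom c' \<inter> chart_dom c)"
  using chart_image_open[OF charts_atD(1)[OF assms(1)] is_chartD(1)[OF charts_atD(1)[OF assms(2)]]]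
    charts_atD(2)[OF assms(1)] charts_atD(2)[OF assms(2)] by auto

lemma linear_transition: "c \<in> charts_at A p \<Longrightarrow> c' \<in> charts_at A p \<Longrightarrow> linear (transition c c' p)"
  using transition_has_derivative has_derivative_linear by blast

text \<open>The cocycle identity, which is the chain rule for the coordinate changes.\<close>

lemma transition_transition:
  assumes c: "c \<in> charts_at A p" "c' \<in> charts_at A p" "c'' \<in> charts_at A p"
  shows "transition c' c'' p (transition c c' p u) = transition c c'' p u"
proof -
  note D = is_chartD[OF charts_atD(1)[OF c(1)]] and D' = is_chartD[OF charts_atD(1)[OF c(2)]]
  have p: "chart_inv c (chart_map c p) = p" using D(6) charts_atD(2)[OF c(1)] by blast
  have "((chart_map c'' \<circ> chart_inv c') \<circ> (chart_map c' \<circ> chart_inv c) has_derivative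
      transition c' c'' p \<circ> transition c c' p) (at (chart_map c p))"
    using diff_chain_at[OF transition_has_derivative[OF c(1,2)]] transition_has_derivative[OF c(2,3)] p by simp
  then have "(chart_map c'' \<circ> chart_inv c has_derivative transition c' c'' p \<circ> transition c c' p) (at (chart_map c p))"
  proof (rule has_derivative_transform_within_open[OF _ overlap_open[OF c(1,2)]])
    fix y assume "y \<in> chart_map c ` (chart_dom c' \<inter> chart_dom c)"
    then show "((chart_map c'' \<circ> chart_inv c') \<circ> (chart_map c' \<circ> chart_inv c)) y = (chart_map c'' \<circ> chart_inv c) y"
      using D(6) D'(6) by auto
  qed
  then have "transition c' c'' p \<circ> transition c c' p = transition c c'' p"
    using has_derivative_unique transition_has_derivative[OF c(1,3)] by blast
  then show ?thesis by (metis comp_apply)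
qed

lemma transition_refl:
  assumes c: "c \<in> charts_at A p"
  shows "transition c c p u = u"
proof -
  note D = is_chartD[OF charts_atD(1)[OF c(1)]]
  have "((\<lambda>y. y) has_derivative transition c c p) (at (chart_map c p))"
  proof (rule has_derivative_transform_within_open[OF transition_has_derivative[OF c c] overlap_open[OF c c]])
    fix y assume "y \<in> chart_map c ` (chart_dom c \<inter> chart_dom c)"
    then show "(chart_map c \<circ> chart_inv c) y = y" using D(6) by auto
  qed
  then have "transition c c p = (\<lambda>y. y)" using has_derivative_unique has_derivative_ident by blast
  then show ?thesis by simp
qed

lemma coord_vector_transition:
  "coord_vector A c p u = (\<lambda>c'. if c' \<in> charts_at A p then transition c c' p u else 0)"
  unfolding coord_vector_def transition_def ..

lemma tangent_space_transition:
  "v \<in> tangent_space A p \<longleftrightarrow> (\<forall>c\<in>charts_at A p. \<forall>c'\<in>charts_at A p. v c' = transition c c' p (v c)) \<and>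
     (\<forall>c. c \<notin> charts_at A p \<longrightarrow> v c = 0)"
  by (simp add: tangent_space_def transition_def)

text \<open>The cocycle identity makes the coordinates compatible. With the next two lemmas,
  \<open>coord_vector A c p\<close> inverts reading off the coordinate in \<open>c\<close>, so a
  single chart identifies the tangent space with \<open>'e\<close>.\<close>

lemma coord_vector_in_tangent_space: "c \<in> charts_at A p \<Longrightarrow> coord_vector A c p u \<in> tangent_space A p"
  by (simp add: tangent_space_transition coord_vector_transition transition_transition)

lemma coord_vector_coord: "c \<in> charts_at A p \<Longrightarrow> coord_vector A c p u c = u"
  by (simp add: coord_vector_transition transition_refl)

lemma coord_vector_of_coord: "c \<in> charts_at A p \<Longrightarrow> v \<in> tangent_space A p \<Longrightarrow> coord_vector A c p (v c) = v"
  unfolding tangent_space_transition coord_vector_transition by (rule ext) (metis (full_types))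

lemma coord_vector_linear:
  assumes "c \<in> charts_at A p"
  shows "coord_vector A c p (a *\<^sub>R u + b *\<^sub>R w) = (\<lambda>c'. a *\<^sub>R coord_vector A c p u c' + b *\<^sub>R coord_vector A c p w c')"
  unfolding coord_vector_transition
  by (rule ext) (simp add: linear_add[OF linear_transition[OF assms]] linear_scale[OF linear_transition[OF assms]])

lemma local_derivative:
  assumes f: "C1_map M A f" and c: "c \<in> charts_at A p" "c' \<in> charts_at A (f p)"
  shows "(chart_map c' \<circ> f \<circ> chart_inv c has_derivative
      frechet_derivative (chart_map c' \<circ> f \<circ> chart_inv c) (at (chart_map c p))) (at (chart_map c p))"
proof (rule C1_has_derivative)
  show "Ck_on 1 (chart_map c' \<circ> f \<circ> chart_inv c) (chart_map c ` {x \<in> chart_dom c. f x \<in> chart_dom c'})"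
    using f c unfolding C1_map_def charts_at_def by blast
qed (use c in \<open>auto simp: charts_at_def\<close>)

text \<open>The same map \<open>chart_map c1' \<circ> f \<circ> chart_inv c\<close> is
  differentiated through two factorizations. This is why the defining formula of
  \<open>differential\<close> is consistent across charts.\<close>

lemma local_derivative_transition:
  assumes f: "C1_map M A f" and c: "c \<in> charts_at A p" "c1 \<in> charts_at A p"
    and c': "c' \<in> charts_at A (f p)" "c1' \<in> charts_at A (f p)"
  shows "frechet_derivative (chart_map c1' \<circ> f \<circ> chart_inv c1) (at (chart_map c1 p)) (transition c c1 p u) =
    transition c' c1' (f p) (frechet_derivative (chart_map c' \<circ> f \<circ> chart_inv c) (at (chart_map c p)) u)"
proof -
  let ?d = "\<lambda>c c'. frechet_derivative (chart_map c' \<circ> f \<circ> chart_inv c) (at (chart_map c p))"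
  note D = is_chartD[OF charts_atD(1)[OF c(1)]] and D1 = is_chartD[OF charts_atD(1)[OF c(2)]]
    and D' = is_chartD[OF charts_atD(1)[OF c'(1)]]
  have p: "chart_inv c (chart_map c p) = p" using D(6) charts_atD(2)[OF c(1)] by blast
  have "((chart_map c1' \<circ> f \<circ> chart_inv c1) \<circ> (chart_map c1 \<circ> chart_inv c) has_derivative
      ?d c1 c1' \<circ> transition c c1 p) (at (chart_map c p))"
    using diff_chain_at[OF transition_has_derivative[OF c]] local_derivative[OF f c(2) c'(2)] p by simp
  then have 1: "(chart_map c1' \<circ> f \<circ> chart_inv c has_derivative ?d c1 c1' \<circ> transition c c1 p) (at (chart_map c p))"
  proof (rule has_derivative_transform_within_open[OF _ overlap_open[OF c]])
    fix y assume "y \<in> chart_map c ` (chart_dom c1 \<inter> chart_dom c)"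
    then show "((chart_map c1' \<circ> f \<circ> chart_inv c1) \<circ> (chart_map c1 \<circ> chart_inv c)) y = (chart_map c1' \<circ> f \<circ> chart_inv c) y"
      using D(6) D1(6) by auto
  qed
  have "((chart_map c1' \<circ> chart_inv c') \<circ> (chart_map c' \<circ> f \<circ> chart_inv c) has_derivative
      transition c' c1' (f p) \<circ> ?d c c') (at (chart_map c p))"
    using diff_chain_at[OF local_derivative[OF f c(1) c'(1)]] transition_has_derivative[OF c'] p by simp
  then have 2: "(chart_map c1' \<circ> f \<circ> chart_inv c has_derivative transition c' c1' (f p) \<circ> ?d c c') (at (chart_map c p))"
  proof (rule has_derivative_transform_within_open)
    show "open (chart_map c ` {x \<in> chart_dom c. f x \<in> chart_dom c'})"
      using c(1) c'(1) by (intro loc_domain_open[OF f]) (auto simp: charts_at_def)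
    show "chart_map c p \<in> chart_map c ` {x \<in> chart_dom c. f x \<in> chart_dom c'}"
      using c(1) c'(1) by (auto simp: charts_at_def)
    fix y assume "y \<in> chart_map c ` {x \<in> chart_dom c. f x \<in> chart_dom c'}"
    then show "((chart_map c1' \<circ> chart_inv c') \<circ> (chart_map c' \<circ> f \<circ> chart_inv c)) y = (chart_map c1' \<circ> f \<circ> chart_inv c) y"
      using D(6) D'(6) by auto
  qed
  have "?d c1 c1' \<circ> transition c c1 p = transition c' c1' (f p) \<circ> ?d c c'" by (rule has_derivative_unique[OF 1 2])
  then show ?thesis by (metis comp_apply)
qed

text \<open>Existence for the \<open>THE\<close> is the compatibility of the local derivatives;
  uniqueness holds because one coordinate determines a tangent vector.\<close>

lemma differential_coord:
  assumes f: "C1_map M A f" and p: "p \<in> M" and v: "v \<in> tangent_space A p"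
  shows "differential A f p v = coord_vector A (ch (f p)) (f p) (der f p (v (ch p)))"
  unfolding differential_def
proof (rule the_equality)
  have fp: "f p \<in> M" using f p by (auto simp: C1_map_def)
  note c = ch_charts_at[OF p] and c' = ch_charts_at[OF fp]
  have "coord_vector A (ch (f p)) (f p) (der f p (v (ch p))) c1' =
      frechet_derivative (chart_map c1' \<circ> f \<circ> chart_inv c1) (at (chart_map c1 p)) (v c1)"
    if "c1 \<in> charts_at A p" "c1' \<in> charts_at A (f p)" for c1 c1'
  proof -
    have "v c1 = transition (ch p) c1 p (v (ch p))" using v c that(1) unfolding tangent_space_transition by blast
    then show ?thesis using local_derivative_transition[OF f c that(1) c' that(2), of "v (ch p)"] that(2)
      by (simp add: coord_vector_transition der_def loc_def pos_def)
  qed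
  then show "coord_vector A (ch (f p)) (f p) (der f p (v (ch p))) \<in> tangent_space A (f p) \<and>
    (\<forall>c\<in>charts_at A p. \<forall>c'\<in>charts_at A (f p). coord_vector A (ch (f p)) (f p) (der f p (v (ch p))) c' =
        frechet_derivative (chart_map c' \<circ> f \<circ> chart_inv c) (at (chart_map c p)) (v c))"
    using coord_vector_in_tangent_space[OF c'] by blast
  fix w assume w: "w \<in> tangent_space A (f p) \<and>
    (\<forall>c\<in>charts_at A p. \<forall>c'\<in>charts_at A (f p). w c' =
        frechet_derivative (chart_map c' \<circ> f \<circ> chart_inv c) (at (chart_map c p)) (v c))"
  then have "w (ch (f p)) = der f p (v (ch p))" using c c' by (simp add: der_def loc_def pos_def)
  then show "w = coord_vector A (ch (f p)) (f p) (der f p (v (ch p)))"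
    using coord_vector_of_coord[OF c'] w by metis
qed

section \<open>The Riemannian norm compared with the coordinate norm\<close>

abbreviation vec :: "'a \<Rightarrow> 'e \<Rightarrow> ('a, 'e) tvector" where
  "vec p \<equiv> coord_vector A (ch p) p"

text \<open>The metric is continuous and positive on the product of the compact core with the unit
  sphere, so it is bounded there from above and away from 0. Homogeneity extends this to all
  vectors.\<close>

lemma metric_chart_bounds:
  assumes g: "riemannian_metric M A g" and c: "c \<in> C"
  shows "\<exists>H\<ge>1. \<forall>y\<in>core c. \<forall>u.
     norm u \<le> H * tangent_norm g (chart_inv c y) (coord_vector A c (chart_inv c y) u) \<and>
     tangent_norm g (chart_inv c y) (coord_vector A c (chart_inv c y) u) \<le> H * norm u"
proof -
  define G where "G y u w = g (chart_inv c y) (coord_vector A c (chart_inv c y) u) (coord_vector A c (chart_inv c y) w)" for y u w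
  have cA: "c \<in> A" using c C by blast
  have at: "c \<in> charts_at A (chart_inv c y)" and inM: "chart_inv c y \<in> M" if "y \<in> core c" for y
  proof -
    have "chart_inv c y \<in> chart_dom c" using is_chartD(8)[OF chC[OF c]] core(2)[OF c] that by blast
    then show "c \<in> charts_at A (chart_inv c y)" "chart_inv c y \<in> M"
      using cA is_chartD(2)[OF chC[OF c]] by (auto simp: charts_at_def)
  qed
  have lin: "linear (\<lambda>u. G y u w)" if y: "y \<in> core c" for y w
  proof -
    have *: "G y (a *\<^sub>R u + b *\<^sub>R v) w = a * G y u w + b * G y v w" for a b u v
      using g inM[OF y] coord_vector_in_tangent_space[OF at[OF y]]
      unfolding G_def coord_vector_linear[OF at[OF y]] riemannian_metric_def by blast
    show ?thesis using *[of 1 _ 1] *[of _ _ 0 0] by (intro linearI) auto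
  qed
  have sym: "G y u w = G y w u" if y: "y \<in> core c" for y u w
    using g inM[OF y] coord_vector_in_tangent_space[OF at[OF y]]
    unfolding G_def riemannian_metric_def by blast
  have pos: "G y u u > 0" if y: "y \<in> core c" and u: "u \<noteq> 0" for y u
  proof -
    have "coord_vector A c (chart_inv c y) u c = u" using coord_vector_coord[OF at[OF y]] .
    then have "coord_vector A c (chart_inv c y) u \<noteq> (\<lambda>_. 0)" using u by auto
    then show ?thesis using g inM[OF y] coord_vector_in_tangent_space[OF at[OF y]]
      unfolding G_def riemannian_metric_def by blast
  qed
  have cont: "continuous_on (core c) (\<lambda>y. G y u w)" for u w
  proof -
    have "smooth_on (\<lambda>y. G y u w) (chart_map c ` chart_dom c)"
      using g cA unfolding riemannian_metric_def G_def by blast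
    then have "Ck_on 0 (\<lambda>y. G y u w) (chart_map c ` chart_dom c)" unfolding smooth_on_def by blast
    then show ?thesis using core(2)[OF c] continuous_on_subset by auto
  qed
  \<comment> \<open>Smoothness of the metric is given for fixed coordinate vectors only. The
    expansion in a basis yields continuity jointly in point and vector.\<close>
  have expand: "G y u u = (\<Sum>i\<in>Basis. \<Sum>j\<in>Basis. (u \<bullet> i) * (u \<bullet> j) * G y j i)" if y: "y \<in> core c" for y u
  proof -
    have e: "G y u w = (\<Sum>i\<in>Basis. (u \<bullet> i) * G y i w)" for u w
    proof -
      have "G y u w = G y (\<Sum>i\<in>Basis. (u \<bullet> i) *\<^sub>R i) w" by (simp add: euclidean_representation)
      also have "\<dots> = (\<Sum>i\<in>Basis. (u \<bullet> i) * G y i w)"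
        by (simp add: linear_sum[OF lin[OF y]] linear_scale[OF lin[OF y]])
      finally show ?thesis .
    qed
    have s: "G y i u = (\<Sum>j\<in>Basis. (u \<bullet> j) * G y j i)" for i
      using sym[OF y, of i u] e[of u i] by simp
    have "G y u u = (\<Sum>i\<in>Basis. (u \<bullet> i) * G y i u)" by (rule e)
    also have "\<dots> = (\<Sum>i\<in>Basis. (u \<bullet> i) * (\<Sum>j\<in>Basis. (u \<bullet> j) * G y j i))"
      by (simp only: s)
    finally show ?thesis by (simp add: sum_distrib_left mult.assoc)
  qed
  define Z where "Z = core c \<times> sphere (0::'e) 1"
  have Z: "compact Z" unfolding Z_def using core(1)[OF c] by (intro compact_Times) auto
  have "continuous_on Z (\<lambda>z. \<Sum>i\<in>Basis. \<Sum>j\<in>Basis. (snd z \<bullet> i) * (snd z \<bullet> j) * G (fst z) j i)"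
    by (intro continuous_intros continuous_on_compose2[OF cont]) (auto simp: Z_def)
  then have cG: "continuous_on Z (\<lambda>z. G (fst z) (snd z) (snd z))"
    by (rule continuous_on_eq) (simp add: expand Z_def mem_Times_iff)
  have Gpos: "G (fst z) (snd z) (snd z) > 0" if "z \<in> Z" for z using that pos unfolding Z_def by (metis mem_Times_iff norm_zero mem_sphere_0 zero_neq_one)
  \<comment> \<open>Bounding the sum of two positive terms bounds the metric and its reciprocal by
    one constant.\<close>
  have "continuous_on Z (\<lambda>z. G (fst z) (snd z) (snd z) + 1 / G (fst z) (snd z) (snd z))"
    by (intro continuous_intros cG ballI) (metis Gpos less_irrefl)
  then have "bounded ((\<lambda>z. G (fst z) (snd z) (snd z) + 1 / G (fst z) (snd z) (snd z)) ` Z)"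
    using compact_continuous_image compact_imp_bounded Z by blast
  then obtain b where b: "\<And>z. z \<in> Z \<Longrightarrow> G (fst z) (snd z) (snd z) + 1 / G (fst z) (snd z) (snd z) \<le> b"
    unfolding bounded_real by (auto simp: abs_le_iff)
  define H where "H = max 1 b"
  have H: "H \<ge> 1" "b \<le> H" by (auto simp: H_def)
  have bd: "G y u u \<le> H" "1 \<le> H * G y u u" if "y \<in> core c" "norm u = 1" for y u
  proof -
    have z: "(y, u) \<in> Z" using that by (simp add: Z_def)
    have gp: "G y u u > 0" using Gpos[OF z] by simp
    then have i: "1 / G y u u > 0" by simp
    have "G y u u + 1 / G y u u \<le> b" using b[OF z] by simp
    then have "G y u u \<le> b" "1 / G y u u \<le> b" using gp i by linarith+
    then have "G y u u \<le> H" "1 / G y u u \<le> H" using H by auto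
    then show "G y u u \<le> H" "1 \<le> H * G y u u" using gp by (auto simp: field_simps)
  qed
  \<comment> \<open>The quadratic form is compared with constant \<open>H\<^sup>2\<close>, so that
    the comparison of norms after taking roots has constant \<open>H\<close>.\<close>
  have sq: "H \<le> H\<^sup>2" using H by (simp add: self_le_power)
  show ?thesis
  proof (intro exI[of _ H] conjI ballI allI H(1))
    fix y and u :: 'e assume y: "y \<in> core c"
    define w where "w = u /\<^sub>R norm u"
    have Gs: "G y (a *\<^sub>R w) (a *\<^sub>R w) = a\<^sup>2 * G y w w" for a w
      using linear_scale[OF lin[OF y]] sym[OF y] by (simp add: power2_eq_square)
    have tn: "tangent_norm g (chart_inv c y) (coord_vector A c (chart_inv c y) u) = sqrt (G y u u)"
      by (simp add: tangent_norm_def G_def)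
    have "(norm u)\<^sup>2 \<le> H\<^sup>2 * G y u u \<and> G y u u \<le> H\<^sup>2 * (norm u)\<^sup>2"
    proof (cases "u = 0")
      case True
      then show ?thesis using Gs[of 0 u] by simp
    next
      case False
      then have w: "norm w = 1" "u = norm u *\<^sub>R w" by (auto simp: w_def)
      have "G y u u = (norm u)\<^sup>2 * G y w w" using Gs[of "norm u" w] unfolding w(2)[symmetric] .
      moreover have gw: "G y w w > 0" using pos[OF y, of w] w(1) by (cases "w = 0") auto
      have "1 \<le> H\<^sup>2 * G y w w" using bd(2)[OF y w(1)] mult_right_mono[OF sq less_imp_le[OF gw]] by linarith
      then have "(norm u)\<^sup>2 * 1 \<le> (norm u)\<^sup>2 * (H\<^sup>2 * G y w w)" by (intro mult_left_mono) auto
      moreover have "(norm u)\<^sup>2 * G y w w \<le> (norm u)\<^sup>2 * H\<^sup>2"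
        using bd(1)[OF y w(1)] sq by (intro mult_left_mono) auto
      ultimately show ?thesis by (simp add: mult_ac)
    qed
    then have "sqrt ((norm u)\<^sup>2) \<le> sqrt (H\<^sup>2 * G y u u)" "sqrt (G y u u) \<le> sqrt (H\<^sup>2 * (norm u)\<^sup>2)"
      by (simp_all only: real_sqrt_le_iff)
    then show "norm u \<le> H * tangent_norm g (chart_inv c y) (coord_vector A c (chart_inv c y) u)"
      "tangent_norm g (chart_inv c y) (coord_vector A c (chart_inv c y) u) \<le> H * norm u"
      using H unfolding tn by (simp_all add: real_sqrt_mult)
  qed
qed

lemma metric_bounds:
  assumes g: "riemannian_metric M A g"
  obtains H where "H \<ge> 1" "\<And>p u. p \<in> M \<Longrightarrow> norm u \<le> H * tangent_norm g p (vec p u)"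
    "\<And>p u. p \<in> M \<Longrightarrow> tangent_norm g p (vec p u) \<le> H * norm u"
    "\<And>p u. p \<in> M \<Longrightarrow> 0 \<le> tangent_norm g p (vec p u)"
proof -
  define P where "P c H \<longleftrightarrow> H \<ge> 1 \<and> (\<forall>y\<in>core c. \<forall>u.
     norm u \<le> H * tangent_norm g (chart_inv c y) (coord_vector A c (chart_inv c y) u) \<and>
     tangent_norm g (chart_inv c y) (coord_vector A c (chart_inv c y) u) \<le> H * norm u)" for c H
  \<comment> \<open>Nonnegativity of the tangent norm is read off from the lower estimate. It is
    needed for that estimate to survive enlarging \<open>H\<close>.\<close>
  have nn: "0 \<le> t" if "norm u \<le> H * t" "H \<ge> 1" for u :: 'e and H t :: real
  proof (rule ccontr)
    assume "\<not> 0 \<le> t"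
    then have "H * t < 0" using that(2) by (intro mult_pos_neg) auto
    then show False using that(1) norm_ge_zero[of u] by linarith
  qed
  have "\<exists>H. \<forall>c\<in>C. P c H"
  proof (rule finite_uniform_bound[OF C(1)])
    show "\<exists>H. P c H" if "c \<in> C" for c using metric_chart_bounds[OF g that] unfolding P_def by blast
    fix c H H' assume P: "P c H" and HH: "H \<le> (H' :: real)"
    have "norm u \<le> H' * tangent_norm g (chart_inv c y) (coord_vector A c (chart_inv c y) u) \<and>
     tangent_norm g (chart_inv c y) (coord_vector A c (chart_inv c y) u) \<le> H' * norm u" if y: "y \<in> core c" for y u
    proof -
      let ?t = "tangent_norm g (chart_inv c y) (coord_vector A c (chart_inv c y) u)"
      have *: "norm u \<le> H * ?t" "?t \<le> H * norm u" "H \<ge> 1" using P y unfolding P_def by blast+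
      show ?thesis using * mult_right_mono[OF HH nn[OF *(1,3)]] mult_right_mono[OF HH norm_ge_zero[of u]] by linarith
    qed
    then show "P c H'" using P HH unfolding P_def by auto
  qed
  then obtain H0 where H0: "\<And>c. c \<in> C \<Longrightarrow> P c H0" by blast
  define H where "H = max 1 H0"
  show thesis
  proof (rule that[of H])
    show H1: "1 \<le> H" by (simp add: H_def)
    fix p u assume p: "p \<in> M"
    have P: "P (ch p) H0" using H0 ch(1)[OF p] by blast
    then have HH: "H = H0" by (simp add: P_def H_def)
    show *: "norm u \<le> H * tangent_norm g p (vec p u)" "tangent_norm g p (vec p u) \<le> H * norm u"
      using P ch(3)[OF p] chart_inv_pos[OF p] unfolding P_def HH pos_def by metis+
    show "0 \<le> tangent_norm g p (vec p u)" by (rule nn[OF *(1) H1])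
  qed
qed

lemma vec_linear_iso:
  assumes p: "p \<in> M" "q \<in> M" and L: "linear L" "bij L"
  shows "tangent_iso A p q (\<lambda>v. vec q (L (v (ch p))))"
  unfolding tangent_iso_def tangent_linear_def
proof (intro conjI ballI allI)
  note at = ch_charts_at[OF p(1)] ch_charts_at[OF p(2)]
  show "(\<lambda>v. vec q (L (v (ch p)))) ` tangent_space A p \<subseteq> tangent_space A q"
    using coord_vector_in_tangent_space[OF at(2)] by auto
  show "vec q (L (a *\<^sub>R v (ch p) + b *\<^sub>R w (ch p))) =
      (\<lambda>c. a *\<^sub>R vec q (L (v (ch p))) c + b *\<^sub>R vec q (L (w (ch p))) c)" for a b v w
    by (simp add: linear_add[OF L(1)] linear_scale[OF L(1)] coord_vector_linear[OF at(2)])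
  show "bij_betw (\<lambda>v. vec q (L (v (ch p)))) (tangent_space A p) (tangent_space A q)"
  proof (rule bij_betw_byWitness[where f' = "\<lambda>w. vec p (inv L (w (ch q)))"])
    show "\<forall>v\<in>tangent_space A p. vec p (inv L (vec q (L (v (ch p))) (ch q))) = v"
      using coord_vector_of_coord[OF at(1)] coord_vector_coord[OF at(2)] bij_is_inj[OF L(2)] by simp
    show "\<forall>w\<in>tangent_space A q. vec q (L (vec p (inv L (w (ch q))) (ch p))) = w"
      using coord_vector_of_coord[OF at(2)] coord_vector_coord[OF at(1)] bij_is_surj[OF L(2)]
      by (simp add: surj_f_inv_f)
  qed (use coord_vector_in_tangent_space[OF at(1)] coord_vector_in_tangent_space[OF at(2)] in auto)
qed

text \<open>Comparing operator norms costs a factor \<open>H\<close> at the source and another at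
  the target. Hence the coordinate tolerance is \<open>e / H\<^sup>2\<close>, and the bound becomes
  \<open>H\<^sup>2 * K\<close>.\<close>

lemma robust_bound_in_charts:
  assumes g: "riemannian_metric M A g" and f: "f \<in> Diff1 M A" and S: "S \<subseteq> M"
    and ub: "uniformly_bounded A g f S n"
  obtains e K where "e > 0" "\<And>p L u. p \<in> S \<Longrightarrow>
      (\<And>i. i < n p \<Longrightarrow> linear (L i) \<and> bij (L i) \<and> (\<forall>z. norm (L i z - der f ((f ^^ i) p) z) \<le> e * norm z))
      \<Longrightarrow> norm (comp_seq L (n p) u) \<le> K * norm u"
proof -
  have C1: "C1_map M A f" using f by (simp add: Diff1_def)
  obtain e K where e: "e > 0" and K: "K > 0" and bound: "\<And>p L. p \<in> S \<Longrightarrow>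
        (\<And>i. i < n p \<Longrightarrow>
           tangent_iso A ((f ^^ i) p) ((f ^^ Suc i) p) (L i) \<and>
           tangent_opnorm A g ((f ^^ i) p) ((f ^^ Suc i) p)
             (\<lambda>v c. L i v c - differential A f ((f ^^ i) p) v c) \<le> e) \<Longrightarrow>
        tangent_opnorm A g p ((f ^^ n p) p) (comp_seq L (n p)) \<le> K"
    using ub unfolding uniformly_bounded_def by blast
  obtain H where H: "H \<ge> 1" and lo: "\<And>p u. p \<in> M \<Longrightarrow> norm u \<le> H * tangent_norm g p (vec p u)"
    and up: "\<And>p u. p \<in> M \<Longrightarrow> tangent_norm g p (vec p u) \<le> H * norm u"
    and nn: "\<And>p u. p \<in> M \<Longrightarrow> 0 \<le> tangent_norm g p (vec p u)"
    using metric_bounds[OF g] by metis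
  have He: "e / H\<^sup>2 > 0" using e H by simp
  show thesis
  proof (rule that[OF He])
    fix p u and \<Lambda> :: "nat \<Rightarrow> 'e \<Rightarrow> 'e"
    assume p: "p \<in> S" and \<Lambda>: "\<And>i. i < n p \<Longrightarrow> linear (\<Lambda> i) \<and> bij (\<Lambda> i) \<and>
        (\<forall>z. norm (\<Lambda> i z - der f ((f ^^ i) p) z) \<le> e / H\<^sup>2 * norm z)"
    have pM: "p \<in> M" using p S by blast
    define q where "q i = (f ^^ i) p" for i
    have qM: "q i \<in> M" for i unfolding q_def by (rule funpow_in_M[OF C1 pM])
    have qS: "f (q i) = q (Suc i)" for i by (simp add: q_def)
    define L where "L i v = vec (q (Suc i)) (\<Lambda> i (v (ch (q i))))" for i and v :: "('a, 'e) tvector"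
    have iso: "tangent_iso A (q i) (q (Suc i)) (L i)" if "i < n p" for i
      unfolding L_def using \<Lambda>[OF that] by (intro vec_linear_iso qM) auto
    have close: "tangent_opnorm A g (q i) (q (Suc i)) (\<lambda>v c. L i v c - differential A f (q i) v c) \<le> e"
      if i: "i < n p" for i
      unfolding tangent_opnorm_def
    proof (rule cSUP_least)
      have "tangent_norm g (q i) (vec (q i) 0) \<le> 1" using up[OF qM, of i 0] by simp
      then show "{v \<in> tangent_space A (q i). tangent_norm g (q i) v \<le> 1} \<noteq> {}"
        using coord_vector_in_tangent_space[OF ch_charts_at[OF qM]] by blast
      fix v assume "v \<in> {v \<in> tangent_space A (q i). tangent_norm g (q i) v \<le> 1}"
      then have v: "v \<in> tangent_space A (q i)" "tangent_norm g (q i) v \<le> 1" by auto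
      define z where "z = v (ch (q i))"
      have vz: "vec (q i) z = v" unfolding z_def by (rule coord_vector_of_coord[OF ch_charts_at[OF qM] v(1)])
      have "(\<lambda>c. L i v c - differential A f (q i) v c) = vec (q (Suc i)) (\<Lambda> i z - der f (q i) z)"
        using coord_vector_linear[OF ch_charts_at[OF qM], of "Suc i" 1 "\<Lambda> i z" "-1" "der f (q i) z"]
        by (simp add: L_def differential_coord[OF C1 qM v(1)] qS z_def)
      then have "tangent_norm g (q (Suc i)) (\<lambda>c. L i v c - differential A f (q i) v c)
          \<le> H * norm (\<Lambda> i z - der f (q i) z)" using up[OF qM] by simp
      also have "\<dots> \<le> H * (e / H\<^sup>2 * norm z)"
        using \<Lambda>[OF i] H unfolding q_def by (intro mult_left_mono) auto
      also have "\<dots> \<le> H * (e / H\<^sup>2 * (H * 1))"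
      proof (intro mult_left_mono)
        have "norm z \<le> H * tangent_norm g (q i) v" using lo[OF qM, of z i] vz by simp
        also have "\<dots> \<le> H * 1" using v(2) H by (intro mult_left_mono) auto
        finally show "norm z \<le> H * 1" .
      qed (use H e in auto)
      also have "\<dots> = e" using H by (simp add: power2_eq_square)
      finally show "tangent_norm g (q (Suc i)) (\<lambda>c. L i v c - differential A f (q i) v c) \<le> e" .
    qed
    have opn: "tangent_opnorm A g p (q (n p)) (comp_seq L (n p)) \<le> K"
      using bound[OF p, of L] iso close unfolding q_def by simp
    \<comment> \<open>\<open>L i\<close> reads the coordinate in the very chart from which the
      preceding vector was built, so the conversions between vectors and coordinates cancel along
      the orbit.\<close>
    have comp: "comp_seq L k (vec p z) = vec (q k) (comp_seq \<Lambda> k z)" for k z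
    proof (induction k)
      case (Suc k)
      then show ?case by (simp add: L_def coord_vector_coord[OF ch_charts_at[OF qM]])
    qed (simp add: q_def)
    have lin: "linear (comp_seq \<Lambda> (n p))" using \<Lambda> by (intro linear_comp_seq) auto
    then have bl: "bounded_linear (comp_seq \<Lambda> (n p))" using linear_conv_bounded_linear by blast
    \<comment> \<open>Without this the supremum defining \<open>tangent_opnorm\<close> would not be
      known to dominate its members.\<close>
    have bdd: "bdd_above ((\<lambda>v. tangent_norm g (q (n p)) (comp_seq L (n p) v)) `
        {v \<in> tangent_space A p. tangent_norm g p v \<le> 1})"
    proof (rule bdd_aboveI2)
      fix v assume "v \<in> {v \<in> tangent_space A p. tangent_norm g p v \<le> 1}"
      then have v: "v \<in> tangent_space A p" "tangent_norm g p v \<le> 1" by auto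
      have vz: "vec p (v (ch p)) = v" by (rule coord_vector_of_coord[OF ch_charts_at[OF pM] v(1)])
      have "tangent_norm g (q (n p)) (comp_seq L (n p) v) \<le> H * norm (comp_seq \<Lambda> (n p) (v (ch p)))"
        using up[OF qM, of "n p"] comp[of "n p" "v (ch p)"] vz by simp
      also have "\<dots> \<le> H * (onorm (comp_seq \<Lambda> (n p)) * norm (v (ch p)))"
        using onorm[OF bl] H by (intro mult_left_mono) auto
      also have "\<dots> \<le> H * (onorm (comp_seq \<Lambda> (n p)) * (H * 1))"
      proof (intro mult_left_mono)
        have "norm (v (ch p)) \<le> H * tangent_norm g p v" using lo[OF pM, of "v (ch p)"] vz by simp
        also have "\<dots> \<le> H * 1" using v(2) H by (intro mult_left_mono) auto
        finally show "norm (v (ch p)) \<le> H * 1" .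
      qed (use H onorm_pos_le[OF bl] in auto)
      finally show "tangent_norm g (q (n p)) (comp_seq L (n p) v) \<le> H * (onorm (comp_seq \<Lambda> (n p)) * (H * 1))" .
    qed
    show "norm (comp_seq \<Lambda> (n p) u) \<le> H\<^sup>2 * K * norm u"
    proof (cases "u = 0")
      case True
      then show ?thesis by (simp add: linear_0[OF lin])
    next
      case False
      \<comment> \<open>The scale puts the tangent vector of \<open>a *\<^sub>R u\<close> into the
        unit ball, whatever its exact Riemannian norm.\<close>
      define a where "a = 1 / (H * norm u)"
      have a: "a > 0" using False H by (simp add: a_def)
      have "tangent_norm g p (vec p (a *\<^sub>R u)) \<le> H * norm (a *\<^sub>R u)" by (rule up[OF pM])
      also have "\<dots> = 1" using False H by (simp add: a_def)
      finally have "tangent_norm g (q (n p)) (comp_seq L (n p) (vec p (a *\<^sub>R u))) \<le> tangent_opnorm A g p (q (n p)) (comp_seq L (n p))"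
        unfolding tangent_opnorm_def
        by (intro cSUP_upper bdd) (simp add: coord_vector_in_tangent_space[OF ch_charts_at[OF pM]])
      then have "tangent_norm g (q (n p)) (vec (q (n p)) (comp_seq \<Lambda> (n p) (a *\<^sub>R u))) \<le> K"
        using opn comp by simp
      then have "H * tangent_norm g (q (n p)) (vec (q (n p)) (comp_seq \<Lambda> (n p) (a *\<^sub>R u))) \<le> H * K"
        using H by (intro mult_left_mono) auto
      then have "norm (comp_seq \<Lambda> (n p) (a *\<^sub>R u)) \<le> H * K" using lo[OF qM] by (rule order_trans[rotated])
      then have "a * norm (comp_seq \<Lambda> (n p) u) \<le> H * K" using a by (simp add: linear_scale[OF lin])
      then show ?thesis using False H by (simp add: a_def field_simps power2_eq_square)
    qed
  qed
qed

end

theorem theorem1: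
  fixes M :: "'a::t2_space set"
    and A :: "('a, 'e::euclidean_space) chart set"
    and g :: "'a \<Rightarrow> ('a, 'e) tvector \<Rightarrow> ('a, 'e) tvector \<Rightarrow> real"
    and f :: "'a \<Rightarrow> 'a"
    and S :: "'a set"
    and n :: "'a \<Rightarrow> nat"
  assumes "closed_manifold M A"
    and "riemannian_metric M A g"
    and "f \<in> Diff1 M A"
    and "S \<subseteq> nonwandering_set M f"
    and "n ` S \<subseteq> {1..}"
    and "finite_preimages S {1..} n"
    and "uniformly_bounded A g f S n"
  shows "finite S"
proof -
  obtain C core where C: "finite C" "C \<subseteq> A" "\<And>c. c \<in> C \<Longrightarrow> compact (core c)"
    "\<And>c. c \<in> C \<Longrightarrow> core c \<subseteq> chart_map c ` chart_dom c"
    "\<And>q. q \<in> M \<Longrightarrow> \<exists>c\<in>C. q \<in> chart_dom c \<and> chart_map c q \<in> core c"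
    using chart_cores[OF assms(1)] by blast
  obtain ch where ch: "\<And>q. q \<in> M \<Longrightarrow> ch q \<in> C \<and> q \<in> chart_dom (ch q) \<and> chart_map (ch q) q \<in> core (ch q)"
    using C(5) by metis
  interpret chart_cover M A C core ch
    by unfold_locales (use assms(1) C ch in auto)
  have SM: "S \<subseteq> M" using assms(4) by (auto simp: nonwandering_set_def)
  obtain e K where "e > 0" "\<And>p L u. p \<in> S \<Longrightarrow>
      (\<And>i. i < n p \<Longrightarrow> linear (L i) \<and> bij (L i) \<and> (\<forall>z. norm (L i z - der f ((f ^^ i) p) z) \<le> e * norm z))
      \<Longrightarrow> norm (comp_seq L (n p) u) \<le> K * norm u"
    by (rule robust_bound_in_charts[OF assms(2,3) SM assms(7)]) blast
  then show ?thesis by (rule finite_of_robust_bound[OF assms(3-6)])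
qed

end
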